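(* Let $\alpha>0$, $0<s<1$, let $V$ satisfy the assumptions listed in the context (with parameters $d\in[1,+\infty)$, $\theta>0$), and let $\mathbb{P}_N$ be the Riesz-gas measure defined in the context. Write $\overline{x_{\max}}=\dfrac{x_{\max}}{(\theta^{-1}\log N)^{1/d}}$. Then: (1) for all $x>1$, $$\limsup_{N\to\infty}\frac{1}{\log N}\log\mathbb{P}_N\left(\overline{x_{\max}}>x\right)\le-I_d(x)$$ and $$\lim_{\delta\to0}\liminf_{N\to\infty}\frac{1}{\log N}\log\mathbb{P}_N\left(\overline{x_{\max}}\in(x-\delta,x+\delta)\right)\ge-I_d(x);$$ (2) for all $x<\left(\dfrac{1-s}{1+s}\right)^{1/d}$, $$\lim_{N\to\infty}\frac{1}{\log N}\log\mathbb{P}_N\left(\overline{x_{\max}}<x\right)=-I_d(x)=-\infty.$$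
   Context: Assumptions on $V$: $V:\mathbb{R}\to\mathbb{R}$ is continuous and $V(x)=\theta|x|^d+\varphi(x)$ with $d\in[1,+\infty)$ real, $\theta>0$, where as $|x|\to\infty$: $\varphi(x)=o(|x|^d)$; $\varphi$ is $\mathcal{C}^2$ outside of a compact set, $\varphi'(x)=o(|x|^{d-1})$, and for any $a<b$, $\sup_{y\in[a,b]}\varphi''(x+y)=o(|x|^{d-2})$. Let $g(x)=|x|^{-s}$ with $0<s<1$. The probability measure $\mathbb{P}_N$ on $\mathbb{R}^N$ is $$d\mathbb{P}_N(x_1,\dots,x_N)=\frac{1}{\mathcal{Z}_N}\prod_{1\le i<j\le N}e^{-\frac{2\alpha}{N}g(x_i-x_j)}\prod_{i=1}^N e^{-V(x_i)}\,dx_1\cdots dx_N,$$ where $\mathcal{Z}_N$ is the normalization constant (finite under the assumptions). $x_{\max}=\max_{1\le i\le N}x_i$. Rate function: $I_d:\mathbb{R}\to[0,+\infty]$, $I_d(x)=x^d-1$ if $x\ge1$ and $I_d(x)=+\infty$ if $x<1$. *)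

theory Defs
  imports "HOL-Probability.Probability" "HOL-Library.Landau_Symbols"
begin

text \<open>
  The complement of a compact set is open, so the two \<open>C1_differentiable_on\<close> conditions say that
  \<open>\<phi>\<close> is twice continuously differentiable there. The supremum is signed (no absolute value) and
  the derivatives only matter for large \<open>\<bar>x\<bar>\<close>, where \<open>deriv\<close> is the genuine derivative.
\<close>

definition admissible_potential :: "(real \<Rightarrow> real) \<Rightarrow> real \<Rightarrow> real \<Rightarrow> bool" where
  "admissible_potential V \<theta> d \<longleftrightarrow>
     continuous_on UNIV V \<and>
     (\<exists>\<phi>. (\<forall>x. V x = \<theta> * \<bar>x\<bar> powr d + \<phi> x) \<and>
       \<phi> \<in> o[at_infinity](\<lambda>x. \<bar>x\<bar> powr d) \<and>
       (\<exists>K. compact K \<and> \<phi> C1_differentiable_on (- K) \<and> deriv \<phi> C1_differentiable_on (- K)) \<and>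
       deriv \<phi> \<in> o[at_infinity](\<lambda>x. \<bar>x\<bar> powr (d - 1)) \<and>
       (\<forall>a b. a < b \<longrightarrow>
         (\<lambda>x. SUP y\<in>{a..b}. deriv (deriv \<phi>) (x + y)) \<in> o[at_infinity](\<lambda>x. \<bar>x\<bar> powr (d - 2))))"

text \<open>\<open>0 powr _ = 0\<close> instead of \<open>\<infinity>\<close>: this concerns a Lebesgue null set of configurations only.\<close>

definition riesz_kernel :: "real \<Rightarrow> real \<Rightarrow> real" where
  "riesz_kernel s x = \<bar>x\<bar> powr (- s)"

definition riesz_weight :: "real \<Rightarrow> real \<Rightarrow> (real \<Rightarrow> real) \<Rightarrow> nat \<Rightarrow> (nat \<Rightarrow> real) \<Rightarrow> real" where
  "riesz_weight \<alpha> s V N x =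
     (\<Prod>i\<in>{1..N}. \<Prod>j\<in>{i<..N}. exp (- (2 * \<alpha> / real N) * riesz_kernel s (x i - x j))) *
     (\<Prod>i\<in>{1..N}. exp (- V (x i)))"

text \<open>Points of $\mathbb{R}^N$ are functions on the index set \<open>{1..N}\<close>.\<close>

abbreviation lborel_N :: "nat \<Rightarrow> (nat \<Rightarrow> real) measure" where
  "lborel_N N \<equiv> (\<Pi>\<^sub>M i\<in>{1..N}. lborel)"

definition riesz_partition :: "real \<Rightarrow> real \<Rightarrow> (real \<Rightarrow> real) \<Rightarrow> nat \<Rightarrow> real" where
  "riesz_partition \<alpha> s V N = (\<integral>x. riesz_weight \<alpha> s V N x \<partial>lborel_N N)"

definition riesz_gas :: "real \<Rightarrow> real \<Rightarrow> (real \<Rightarrow> real) \<Rightarrow> nat \<Rightarrow> (nat \<Rightarrow> real) measure" where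
  "riesz_gas \<alpha> s V N =
     density (lborel_N N) (\<lambda>x. ennreal (riesz_weight \<alpha> s V N x / riesz_partition \<alpha> s V N))"

definition x_max :: "nat \<Rightarrow> (nat \<Rightarrow> real) \<Rightarrow> real" where
  "x_max N x = Max (x ` {1..N})"

definition scaled_x_max :: "real \<Rightarrow> real \<Rightarrow> nat \<Rightarrow> (nat \<Rightarrow> real) \<Rightarrow> real" where
  "scaled_x_max \<theta> d N x = x_max N x / (ln (real N) / \<theta>) powr (1 / d)"

definition xmax_prob ::
    "real \<Rightarrow> real \<Rightarrow> (real \<Rightarrow> real) \<Rightarrow> real \<Rightarrow> real \<Rightarrow> nat \<Rightarrow> real set \<Rightarrow> real" where
  "xmax_prob \<alpha> s V \<theta> d N A =
     measure (riesz_gas \<alpha> s V N) {x \<in> space (riesz_gas \<alpha> s V N). scaled_x_max \<theta> d N x \<in> A}"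

text \<open>The logarithm of a probability, with \<open>log 0 = - \<infinity>\<close> (the library has \<open>ln 0 = 0\<close>).\<close>

definition log_prob :: "real \<Rightarrow> ereal" where
  "log_prob p = (if p = 0 then - \<infinity> else ereal (ln p))"

definition rate :: "real \<Rightarrow> real \<Rightarrow> ereal" where
  "rate d x = (if x \<ge> 1 then ereal (x powr d - 1) else \<infinity>)"

end

theory Submission
  imports Defs "HOL-Real_Asymp.Real_Asymp"
begin

text \<open>
  The interaction felt by one particle is a factor at most \<open>1\<close>, and by Jensen's inequality its
  average over a unit interval is bounded below uniformly in \<open>N\<close> and in the positions of the others.
  Hence moving one particle from a set \<open>B\<close> into a unit interval costs, up to constants, only the
  ratio of the \<open>exp (- V)\<close> masses (the exchange inequality). Moving a particle from the far right
  to \<open>[0, 1]\<close> and summing over the particles gives the upper tail; moving a typical particle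
  near \<open>x (log N / \<theta>)\<^sup>1\<^sup>/\<^sup>d\<close> gives the lower bound. For the lower tail,
  let \<open>A\<^sub>k\<close> be the event that exactly \<open>k\<close> particles lie right of this level. Moving one
  of about \<open>N\<close> particles across gives \<open>P(A\<^sub>k) \<le> C\<^sub>k N\<^sup>-\<^sup>\<gamma> P(A\<^sub>k\<^sub>+\<^sub>1)\<close> for some
  \<open>\<gamma> > 0\<close> whenever \<open>x < 1\<close>, so \<open>P(A\<^sub>0)\<close> decays faster than every power of \<open>N\<close>.
\<close>

subsection \<open>The single-particle interaction\<close>

text \<open>At distance at least 1 from \<open>z\<close> the kernel is at most 1, which contributes
  the summand 1. Nearer to \<open>z\<close> the singularity is integrable because
  \<open>s < 1\<close>, with total mass \<open>2 / (1 - s)\<close>. The bound depends on neither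
  \<open>a\<close> nor \<open>z\<close>, so it can be summed over all the other particles.\<close>

lemma nn_integral_riesz_kernel_le:
  assumes "0 < s" "s < 1"
  shows "(\<integral>\<^sup>+y. ennreal (riesz_kernel s (y - z)) * indicator {a..a+1} y \<partial>lborel)
    \<le> ennreal (1 + 2 / (1 - s))"
proof -
  define g where "g = (\<lambda>u::real. \<bar>u\<bar> powr (- s))"
  have g_borel [measurable]: "g \<in> borel_measurable borel"
    unfolding g_def by measurable
  have right: "(g has_integral 1 / (1 - s)) {0..1}"
  proof (rule has_integral_eq)
    show "((\<lambda>u. u powr (- s)) has_integral 1 / (1 - s)) {0..1}"
      using has_integral_powr_from_0[of "- s" 1] assms by simp
  qed (simp add: g_def)
  have "((\<lambda>u. g (- u)) has_integral 1 / (1 - s)) {-1..-0}"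
    using right by (rule has_integral_reflect_lemma_real)
  then have left: "(g has_integral 1 / (1 - s)) {-1..0}"
    by (simp add: g_def)
  have "(g has_integral (1 / (1 - s) + 1 / (1 - s))) {-1..1}"
    by (rule has_integral_combine[OF _ _ left right]) auto
  then have "(\<integral>\<^sup>+u. ennreal (g u) * indicator {-1..1} u \<partial>lborel) = ennreal (1 / (1 - s) + 1 / (1 - s))"
    by (rule nn_integral_has_integral_lebesgue'[rotated]) (simp add: g_def)
  also have "(\<integral>\<^sup>+u. ennreal (g u) * indicator {-1..1} u \<partial>lborel)
      = (\<integral>\<^sup>+y. ennreal (g (y - z)) * indicator {-1..1} (y - z) \<partial>lborel)"
    by (subst nn_integral_real_affine[where c = 1 and t = "- z"]) simp_all
  finally have near: "(\<integral>\<^sup>+y. ennreal (g (y - z)) * indicator {-1..1} (y - z) \<partial>lborel)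
      = ennreal (2 / (1 - s))"
    by simp
  have "(\<integral>\<^sup>+y. ennreal (riesz_kernel s (y - z)) * indicator {a..a+1} y \<partial>lborel)
      \<le> (\<integral>\<^sup>+y. indicator {a..a+1} y + ennreal (g (y - z)) * indicator {-1..1} (y - z) \<partial>lborel)"
  proof (rule nn_integral_mono)
    fix y :: real
    show "ennreal (riesz_kernel s (y - z)) * indicator {a..a+1} y
      \<le> indicator {a..a+1} y + ennreal (g (y - z)) * indicator {-1..1} (y - z)"
    proof (cases "y - z \<in> {-1..1}")
      case True
      then show ?thesis
        by (auto simp: riesz_kernel_def g_def split: split_indicator)
    next
      case False
      then have "1 \<le> \<bar>y - z\<bar>" by auto
      then have "\<bar>y - z\<bar> powr (- s) \<le> 1"
        using assms powr_mono[of "- s" 0 "\<bar>y - z\<bar>"] by (auto split: if_splits)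
      then show ?thesis
        using False by (auto simp: riesz_kernel_def split: split_indicator)
    qed
  qed
  also have "\<dots> = ennreal 1 + ennreal (2 / (1 - s))"
    by (subst nn_integral_add) (auto simp: near)
  also have "\<dots> = ennreal (1 + 2 / (1 - s))"
    using assms by (subst ennreal_plus) auto
  finally show ?thesis .
qed

lemma riesz_kernel_nonneg: "0 \<le> riesz_kernel s x"
  by (simp add: riesz_kernel_def)

lemma borel_measurable_riesz_kernel [measurable]: "riesz_kernel s \<in> borel_measurable borel"
  unfolding riesz_kernel_def by measurable

text \<open>The coupling \<open>2 * \<alpha> / N\<close> times at most \<open>N\<close> other
  particles gives \<open>2 * \<alpha>\<close>. The second factor is the kernel bound over a unit
  interval. The product bounds the mean interaction energy of a particle spread uniformly over such
  an interval.\<close>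

definition screening :: "real \<Rightarrow> real \<Rightarrow> real" where
  "screening \<alpha> s = 2 * \<alpha> * (1 + 2 / (1 - s))"

text \<open>Jensen's inequality on an interval of length 1: the mean of \<open>exp (- u)\<close> is
  at least the exponential of minus the mean energy, and that energy is at most
  \<open>screening \<alpha> s\<close>. The hypothesis on \<open>\<beta> * card J\<close> makes the
  number of particles drop out.\<close>

lemma nn_integral_boltzmann_ge:
  assumes "0 < s" "s < 1" "0 \<le> \<beta>" "finite J" "\<beta> * real (card J) \<le> 2 * \<alpha>" "0 < \<alpha>"
  shows "ennreal (exp (- screening \<alpha> s)) \<le>
    (\<integral>\<^sup>+y. ennreal (exp (- \<beta> * (\<Sum>j\<in>J. riesz_kernel s (y - x j)))) * indicator {a..a+1} y \<partial>lborel)"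
proof -
  define K where "K = screening \<alpha> s"
  define u where "u y = \<beta> * (\<Sum>j\<in>J. riesz_kernel s (y - x j))" for y
  have u_nonneg: "0 \<le> u y" for y
    unfolding u_def using assms by (intro mult_nonneg_nonneg sum_nonneg riesz_kernel_nonneg) auto
  have u_meas [measurable]: "u \<in> borel_measurable borel"
    unfolding u_def by measurable
  have K_nonneg: "0 \<le> K"
    using assms unfolding K_def screening_def by simp
  have eq: "ennreal (u y) * indicator {a..a+1} y = ennreal \<beta> *
      (\<Sum>j\<in>J. ennreal (riesz_kernel s (y - x j)) * indicator {a..a+1} y)" for y
    unfolding u_def using assms
    by (simp add: ennreal_mult' riesz_kernel_nonneg sum_nonneg flip: sum_ennreal sum_distrib_right)
       (simp add: mult.assoc)
  have "(\<integral>\<^sup>+y. ennreal (u y) * indicator {a..a+1} y \<partial>lborel)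
      = ennreal \<beta> * (\<Sum>j\<in>J. \<integral>\<^sup>+y. ennreal (riesz_kernel s (y - x j)) * indicator {a..a+1} y \<partial>lborel)"
    unfolding eq by (subst nn_integral_cmult) (auto simp: nn_integral_sum)
  also have "\<dots> \<le> ennreal \<beta> * (\<Sum>j\<in>J. ennreal (1 + 2 / (1 - s)))"
    using assms by (intro mult_left_mono sum_mono nn_integral_riesz_kernel_le) auto
  also have "\<dots> = ennreal (\<beta> * real (card J) * (1 + 2 / (1 - s)))"
    using assms by (simp add: ennreal_mult ennreal_of_nat_eq_real_of_nat mult.assoc)
  also have "\<dots> \<le> ennreal K"
    unfolding K_def screening_def using assms by (intro ennreal_leI mult_right_mono) auto
  finally have int_u: "(\<integral>\<^sup>+y. ennreal (u y) * indicator {a..a+1} y \<partial>lborel) \<le> ennreal K" .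
  txt \<open>The tangent line of the exponential at \<open>- K\<close> plays the role of Jensen's inequality.\<close>
  have tangent: "exp (- K) * (1 + K) \<le> exp (- u y) + exp (- K) * u y" for y
  proof -
    have "exp (- K) * (1 + (K - u y)) \<le> exp (- K) * exp (K - u y)"
      by (intro mult_left_mono) (auto simp: exp_ge_add_one_self)
    also have "\<dots> = exp (- u y)"
      by (simp flip: exp_add)
    finally show ?thesis by (simp add: algebra_simps)
  qed
  let ?X = "\<integral>\<^sup>+y. ennreal (exp (- u y)) * indicator {a..a+1} y \<partial>lborel"
  \<comment> \<open>The integrated left side is split so that the finite summand
    \<open>exp (- K) * K\<close> also appears on the right and can be cancelled in
    \<open>ennreal\<close>.\<close>
  have "ennreal (exp (- K) * K) + ennreal (exp (- K))
      = (\<integral>\<^sup>+y. ennreal (exp (- K) * (1 + K)) * indicator {a..a+1} y \<partial>lborel)"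
    using K_nonneg by (subst nn_integral_cmult) (simp_all add: distrib_left add.commute)
  also have "\<dots> \<le> (\<integral>\<^sup>+y. ennreal (exp (- u y)) * indicator {a..a+1} y
      + ennreal (exp (- K)) * (ennreal (u y) * indicator {a..a+1} y) \<partial>lborel)"
  proof (rule nn_integral_mono)
    fix y
    show "ennreal (exp (- K) * (1 + K)) * indicator {a..a+1} y \<le> ennreal (exp (- u y)) * indicator {a..a+1} y
      + ennreal (exp (- K)) * (ennreal (u y) * indicator {a..a+1} y)"
      using tangent[of y] u_nonneg[of y]
      by (auto split: split_indicator intro!: ennreal_leI simp flip: ennreal_plus ennreal_mult)
  qed
  also have "\<dots> = ?X + ennreal (exp (- K)) * (\<integral>\<^sup>+y. ennreal (u y) * indicator {a..a+1} y \<partial>lborel)"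
    by (subst nn_integral_add) (auto simp: nn_integral_cmult)
  also have "\<dots> \<le> ?X + ennreal (exp (- K)) * ennreal K"
    using int_u by (intro add_left_mono mult_left_mono) auto
  also have "\<dots> = ennreal (exp (- K) * K) + ?X"
    using K_nonneg by (simp add: ennreal_mult add.commute)
  finally have "ennreal (exp (- K)) \<le> ?X"
    by (subst (asm) ennreal_add_left_cancel_le) auto
  then show ?thesis
    by (simp add: u_def K_def)
qed

text \<open>\<open>R\<close> collects the pair factors and potentials of the particles other than
  \<open>i\<close>, so it is the same for every \<open>y\<close>. Pairs containing \<open>i\<close>
  occur in both orders and are merged by the symmetry of the kernel.\<close>

lemma riesz_weight_split:
  assumes i: "i \<in> {1..N}"
  obtains R where "0 \<le> R" and "\<And>y. riesz_weight \<alpha> s V N (x(i := y)) =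
    R * (exp (- (2 * \<alpha> / real N) * (\<Sum>j\<in>{1..N} - {i}. riesz_kernel s (y - x j))) * exp (- V y))"
proof -
  define J where "J = {1..N} - {i}"
  define \<beta> where "\<beta> = 2 * \<alpha> / real N"
  define f where "f u v = exp (- \<beta> * riesz_kernel s (u - v))" for u v
  have f_sym: "f u v = f v u" for u v
    by (simp add: f_def riesz_kernel_def abs_minus_commute)
  define R where "R = (\<Prod>a\<in>J. \<Prod>b\<in>{a<..N} - {i}. f (x a) (x b)) * (\<Prod>a\<in>J. exp (- V (x a)))"
  have I: "{1..N} = insert i J" and J: "finite J" "i \<notin> J"
    using i by (auto simp: J_def)
  \<comment> \<open>Each pair sits in the row of its smaller index. Row \<open>a\<close> therefore
    meets \<open>i\<close> only when \<open>a < i\<close>; the remaining pairs with \<open>i\<close>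
    form row \<open>i\<close> itself.\<close>
  have inner: "(\<Prod>b\<in>{a<..N}. f (x a) ((x(i := y)) b))
      = (\<Prod>b\<in>{a<..N} - {i}. f (x a) (x b)) * (if a < i then f y (x a) else 1)" if "a \<in> J" for a y
  proof (cases "a < i")
    case True
    then have "{a<..N} = insert i ({a<..N} - {i})" using i by auto
    then have "(\<Prod>b\<in>{a<..N}. f (x a) ((x(i := y)) b)) =
        (\<Prod>b\<in>insert i ({a<..N} - {i}). f (x a) ((x(i := y)) b))" by simp
    also have "\<dots> = f (x a) y * (\<Prod>b\<in>{a<..N} - {i}. f (x a) ((x(i := y)) b))"
      by (subst prod.insert) auto
    also have "(\<Prod>b\<in>{a<..N} - {i}. f (x a) ((x(i := y)) b)) = (\<Prod>b\<in>{a<..N} - {i}. f (x a) (x b))"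
      by (intro prod.cong) auto
    finally show ?thesis
      using True f_sym by simp
  next
    case False
    then show ?thesis by (auto intro!: prod.cong)
  qed
  have "riesz_weight \<alpha> s V N (x(i := y)) = R * ((\<Prod>j\<in>J. f y (x j)) * exp (- V y))" for y
  proof -
    have "(\<Prod>a\<in>{1..N}. \<Prod>b\<in>{a<..N}. f ((x(i := y)) a) ((x(i := y)) b))
        = (\<Prod>b\<in>{i<..N}. f y (x b)) * (\<Prod>a\<in>J. \<Prod>b\<in>{a<..N}. f (x a) ((x(i := y)) b))"
      unfolding I by (subst prod.insert[OF J]) (use J in \<open>auto intro!: prod.cong arg_cong2[where f = "(*)"]\<close>)
    also have "(\<Prod>a\<in>J. \<Prod>b\<in>{a<..N}. f (x a) ((x(i := y)) b))
        = (\<Prod>a\<in>J. \<Prod>b\<in>{a<..N} - {i}. f (x a) (x b)) * (\<Prod>a\<in>J. if a < i then f y (x a) else 1)"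
      by (simp add: inner prod.distrib cong: prod.cong del: fun_upd_apply)
    also have "(\<Prod>a\<in>J. if a < i then f y (x a) else 1) = (\<Prod>a\<in>{1..<i}. f y (x a))"
      using i by (intro prod.mono_neutral_cong_right) (auto simp: J_def)
    also have "(\<Prod>b\<in>{i<..N}. f y (x b)) * ((\<Prod>a\<in>J. \<Prod>b\<in>{a<..N} - {i}. f (x a) (x b)) * (\<Prod>a\<in>{1..<i}. f y (x a)))
       = (\<Prod>a\<in>J. \<Prod>b\<in>{a<..N} - {i}. f (x a) (x b)) * (\<Prod>j\<in>{1..<i} \<union> {i<..N}. f y (x j))"
      by (subst prod.union_disjoint) auto
    also have "{1..<i} \<union> {i<..N} = J"
      using i by (auto simp: J_def)
    finally have 1: "(\<Prod>a\<in>{1..N}. \<Prod>b\<in>{a<..N}. f ((x(i := y)) a) ((x(i := y)) b))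
        = (\<Prod>a\<in>J. \<Prod>b\<in>{a<..N} - {i}. f (x a) (x b)) * (\<Prod>j\<in>J. f y (x j))" .
    have 2: "(\<Prod>a\<in>{1..N}. exp (- V ((x(i := y)) a))) = exp (- V y) * (\<Prod>a\<in>J. exp (- V (x a)))"
      unfolding I by (subst prod.insert[OF J]) (use J in \<open>auto intro!: prod.cong\<close>)
    show ?thesis
      using 1 2 unfolding riesz_weight_def R_def f_def \<beta>_def by simp
  qed
  moreover have "(\<Prod>j\<in>J. f y (x j)) = exp (- \<beta> * (\<Sum>j\<in>J. riesz_kernel s (y - x j)))" for y
    by (simp add: f_def exp_sum[symmetric] J sum_distrib_left sum_negf)
  moreover have "0 \<le> R"
    unfolding R_def f_def by (intro mult_nonneg_nonneg prod_nonneg) auto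
  ultimately show ?thesis
    using that unfolding \<beta>_def J_def by metis
qed

subsection \<open>The exchange inequality\<close>

lemma borel_measurable_riesz_weight [measurable]:
  assumes [measurable]: "V \<in> borel_measurable borel"
  shows "riesz_weight \<alpha> s V N \<in> borel_measurable (lborel_N N)"
  unfolding riesz_weight_def
proof (intro borel_measurable_times borel_measurable_prod)
  fix i j assume "i \<in> {1..N}" "j \<in> {i<..N}"
  then have [measurable]: "(\<lambda>x. x i) \<in> borel_measurable (lborel_N N)" "(\<lambda>x. x j) \<in> borel_measurable (lborel_N N)"
    using measurable_component_singleton[of i "{1..N}" "\<lambda>_. lborel"]
      measurable_component_singleton[of j "{1..N}" "\<lambda>_. lborel"] by auto
  show "(\<lambda>x. exp (- (2 * \<alpha> / real N) * riesz_kernel s (x i - x j))) \<in> borel_measurable (lborel_N N)"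
    by measurable
next
  fix i assume "i \<in> {1..N}"
  then have [measurable]: "(\<lambda>x. x i) \<in> borel_measurable (lborel_N N)"
    using measurable_component_singleton[of i "{1..N}" "\<lambda>_. lborel"] by auto
  show "(\<lambda>x. exp (- V (x i))) \<in> borel_measurable (lborel_N N)"
    by measurable
qed

lemma riesz_weight_pos: "0 < riesz_weight \<alpha> s V N x"
  unfolding riesz_weight_def by (intro mult_pos_pos prod_pos) auto

text \<open>Repulsion makes every pair factor at most 1, so the non-interacting weight dominates;
  this gives integrability.\<close>

lemma riesz_weight_le:
  assumes "0 \<le> \<alpha>"
  shows "riesz_weight \<alpha> s V N x \<le> (\<Prod>i\<in>{1..N}. exp (- V (x i)))"
proof -
  have "(\<Prod>i\<in>{1..N}. \<Prod>j\<in>{i<..N}. exp (- (2 * \<alpha> / real N) * riesz_kernel s (x i - x j))) \<le> 1"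
    using assms by (intro prod_le_1 prod_nonneg conjI) (auto intro!: prod_le_1 prod_nonneg mult_nonneg_nonneg divide_nonneg_nonneg riesz_kernel_nonneg)
  then show ?thesis
    unfolding riesz_weight_def by (intro mult_left_le_one_le prod_nonneg) auto
qed

locale riesz_ensemble =
  fixes \<alpha> s :: real and V :: "real \<Rightarrow> real"
  assumes \<alpha>_pos: "0 < \<alpha>" and s_pos: "0 < s" and s_less_1: "s < 1"
    and V_borel [measurable]: "V \<in> borel_measurable borel"
    and integrable_exp_V: "integrable lborel (\<lambda>y. exp (- V y))"
begin

text \<open>The one-particle measure without interaction, left unnormalised: its total mass enters
  only multiplicative constants, which vanish on the logarithmic scale.\<close>

definition gibbs :: "real measure" where
  "gibbs = density lborel (\<lambda>y. ennreal (exp (- V y)))"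

sublocale gibbs: finite_measure gibbs
proof
  have "(\<integral>\<^sup>+y. ennreal (exp (- V y)) \<partial>lborel) < \<infinity>"
    using integrable_exp_V by (simp add: integrable_iff_bounded)
  then show "emeasure gibbs (space gibbs) \<noteq> \<infinity>"
    unfolding gibbs_def by (subst emeasure_density) auto
qed

lemma sets_gibbs [measurable_cong, simp]: "sets gibbs = sets borel"
  by (simp add: gibbs_def)

lemma space_gibbs [simp]: "space gibbs = UNIV"
  by (simp add: gibbs_def)

lemma riesz_weight_integrable: "integrable (lborel_N N) (riesz_weight \<alpha> s V N)"
proof (rule Bochner_Integration.integrable_bound)
  interpret product_sigma_finite "\<lambda>_::nat. lborel :: real measure"
    by standard
  show "integrable (lborel_N N) (\<lambda>x. \<Prod>i\<in>{1..N}. exp (- V (x i)))"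
    by (rule product_integrable_prod) (auto intro: integrable_exp_V)
  show "AE x in lborel_N N. norm (riesz_weight \<alpha> s V N x) \<le> norm (\<Prod>i\<in>{1..N}. exp (- V (x i)))"
    using riesz_weight_le[of \<alpha> s V N] riesz_weight_pos[of \<alpha> s V N] \<alpha>_pos
    by (intro AE_I2) (auto simp: abs_of_pos prod_nonneg less_imp_le)
qed measurable

text \<open>The weight is strictly positive, so its integral could vanish only on a null space. The
  total Lebesgue mass is a product of infinities, or 1 for \<open>N = 0\<close>, hence not
  zero.\<close>

lemma riesz_partition_pos: "0 < riesz_partition \<alpha> s V N"
proof -
  interpret product_sigma_finite "\<lambda>_::nat. lborel :: real measure"
    by standard
  have "emeasure (lborel_N N) (space (lborel_N N)) = (\<Prod>i\<in>{1..N}. emeasure lborel (UNIV :: real set))"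
    unfolding space_PiM space_lborel space_borel by (rule emeasure_PiM) auto
  then have "emeasure (lborel_N N) (space (lborel_N N)) \<noteq> 0"
    by (simp add: emeasure_lborel_UNIV)
  then have "\<not> (AE x in lborel_N N. False)"
    by (auto simp: eventually_False ae_filter_eq_bot_iff simp del: One_nat_def)
  moreover have "riesz_weight \<alpha> s V N x \<noteq> 0" for x
    using riesz_weight_pos[of \<alpha> s V N x] by simp
  ultimately have "riesz_partition \<alpha> s V N \<noteq> 0"
    unfolding riesz_partition_def using riesz_weight_pos[of \<alpha> s V N]
    by (subst integral_nonneg_eq_0_iff_AE[OF riesz_weight_integrable]) (auto intro: less_imp_le)
  moreover have "0 \<le> riesz_partition \<alpha> s V N"
    unfolding riesz_partition_def using riesz_weight_pos[of \<alpha> s V N]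
    by (intro Bochner_Integration.integral_nonneg) (auto intro: less_imp_le)
  ultimately show ?thesis by simp
qed

lemma sets_riesz_gas [measurable_cong, simp]: "sets (riesz_gas \<alpha> s V N) = sets (lborel_N N)"
  by (simp add: riesz_gas_def)

lemma space_riesz_gas [simp]: "space (riesz_gas \<alpha> s V N) = space (lborel_N N)"
  by (simp add: riesz_gas_def)

lemma prob_space_riesz_gas: "prob_space (riesz_gas \<alpha> s V N)"
proof
  let ?Z = "riesz_partition \<alpha> s V N"
  have "emeasure (riesz_gas \<alpha> s V N) (space (riesz_gas \<alpha> s V N))
      = (\<integral>\<^sup>+x. ennreal (riesz_weight \<alpha> s V N x / ?Z) \<partial>lborel_N N)"
    unfolding riesz_gas_def space_density
    by (auto simp: emeasure_density simp del: One_nat_def intro!: nn_integral_cong)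
  also have "\<dots> = ennreal (\<integral>x. riesz_weight \<alpha> s V N x / ?Z \<partial>lborel_N N)"
    using riesz_weight_pos[of \<alpha> s V N] riesz_partition_pos[of N]
    by (intro nn_integral_eq_integral integrable_divide riesz_weight_integrable AE_I2) (auto simp: less_imp_le)
  also have "(\<integral>x. riesz_weight \<alpha> s V N x / ?Z \<partial>lborel_N N) = 1"
    using riesz_partition_pos[of N] by (simp add: riesz_partition_def)
  finally show "emeasure (riesz_gas \<alpha> s V N) (space (riesz_gas \<alpha> s V N)) = 1" by simp
qed

text \<open>All coordinates but \<open>i\<close> are frozen. Integrating coordinate \<open>i\<close>
  over \<open>B\<close> gives at most a factor \<open>c\<close> times the Gibbs mass of
  \<open>B\<close>, since the interaction factor is at most 1. Integrating it over the unit interval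
  gives at least \<open>c * exp (- screening \<alpha> s - M)\<close>, by the Jensen bound and
  \<open>V \<le> M\<close>. The predicate \<open>Q\<close> carries a condition on the other
  particles that survives the move.\<close>

lemma emeasure_exchange:
  assumes i: "i \<in> {1..N}" and B: "B \<in> sets borel"
    and Q [measurable]: "Measurable.pred (lborel_N N) Q"
    and Q_upd: "\<And>x y. Q (x(i := y)) = Q x"
    and V_le: "\<And>y. y \<in> {a..a+1} \<Longrightarrow> V y \<le> M"
  shows "ennreal (exp (- screening \<alpha> s - M)) *
      emeasure (riesz_gas \<alpha> s V N) {x \<in> space (lborel_N N). x i \<in> B \<and> Q x}
    \<le> emeasure gibbs B * emeasure (riesz_gas \<alpha> s V N) {x \<in> space (lborel_N N). x i \<in> {a..a+1} \<and> Q x}"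
proof -
  interpret product_sigma_finite "\<lambda>_::nat. lborel :: real measure"
    by standard
  define J where "J = {1..N} - {i}"
  have I: "{1..N} = insert i J" and J: "finite J" "i \<notin> J"
    using i by (auto simp: J_def)
  let ?Z = "riesz_partition \<alpha> s V N"
  define w where "w x = ennreal (riesz_weight \<alpha> s V N x / ?Z)" for x
  have w_meas [measurable]: "w \<in> borel_measurable (lborel_N N)"
    unfolding w_def by measurable
  have comp [measurable]: "(\<lambda>x. x i) \<in> borel_measurable (lborel_N N)"
    using i measurable_component_singleton[of i "{1..N}" "\<lambda>_. lborel"] by auto
  \<comment> \<open>Fubini with coordinate \<open>i\<close> innermost; \<open>Q\<close> leaves the
    inner integral because it ignores that coordinate.\<close>
  have disint: "emeasure (riesz_gas \<alpha> s V N) {x \<in> space (lborel_N N). x i \<in> B' \<and> Q x}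
      = (\<integral>\<^sup>+x. (\<integral>\<^sup>+y. w (x(i := y)) * indicator B' y \<partial>lborel) * indicator (Collect Q) x \<partial>Pi\<^sub>M J (\<lambda>_. lborel))"
    if [measurable]: "B' \<in> sets borel" for B'
  proof -
    have "emeasure (riesz_gas \<alpha> s V N) {x \<in> space (lborel_N N). x i \<in> B' \<and> Q x}
        = (\<integral>\<^sup>+x. w x * indicator {x \<in> space (lborel_N N). x i \<in> B' \<and> Q x} x \<partial>lborel_N N)"
      unfolding riesz_gas_def w_def by (subst emeasure_density) measurable
    also have "\<dots> = (\<integral>\<^sup>+x. w x * (indicator B' (x i) * indicator (Collect Q) x) \<partial>lborel_N N)"
      by (intro nn_integral_cong) (auto split: split_indicator)
    also have "\<dots> = (\<integral>\<^sup>+x. (\<integral>\<^sup>+y. w (x(i := y)) * (indicator B' ((x(i := y)) i) * indicator (Collect Q) (x(i := y)))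
        \<partial>lborel) \<partial>Pi\<^sub>M J (\<lambda>_. lborel))"
      unfolding I
    proof (rule product_nn_integral_insert[OF J])
      show "(\<lambda>x. w x * (indicator B' (x i) * indicator (Collect Q) x)) \<in> borel_measurable (Pi\<^sub>M (insert i J) (\<lambda>_. lborel))"
        unfolding I[symmetric] by measurable
    qed
    also have "\<dots> = (\<integral>\<^sup>+x. (\<integral>\<^sup>+y. w (x(i := y)) * indicator B' y \<partial>lborel) * indicator (Collect Q) x \<partial>Pi\<^sub>M J (\<lambda>_. lborel))"
      by (intro nn_integral_cong) (auto simp: Q_upd indicator_def)
    finally show ?thesis .
  qed
  \<comment> \<open>The upper and lower bounds share the factor \<open>c = R / Z\<close>. They are
    multiplied crosswise, so \<open>c\<close> is never divided by and may be zero.\<close>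
  have inner: "ennreal (exp (- screening \<alpha> s - M)) * (\<integral>\<^sup>+y. w (x(i := y)) * indicator B y \<partial>lborel)
    \<le> emeasure gibbs B * (\<integral>\<^sup>+y. w (x(i := y)) * indicator {a..a+1} y \<partial>lborel)" for x
  proof -
    obtain R where R: "0 \<le> R" and weight: "\<And>y. riesz_weight \<alpha> s V N (x(i := y)) =
        R * (exp (- (2 * \<alpha> / real N) * (\<Sum>j\<in>J. riesz_kernel s (y - x j))) * exp (- V y))"
      using riesz_weight_split[OF i] unfolding J_def by metis
    define h where "h y = exp (- (2 * \<alpha> / real N) * (\<Sum>j\<in>J. riesz_kernel s (y - x j)))" for y
    have h_meas [measurable]: "h \<in> borel_measurable borel"
      unfolding h_def by measurable
    have h_le: "h y \<le> 1" for y
      unfolding h_def using \<alpha>_pos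
      by (auto intro!: divide_nonneg_nonneg mult_nonneg_nonneg sum_nonneg riesz_kernel_nonneg)
    have h_pos: "0 < h y" for y
      by (simp add: h_def)
    define c where "c = R / ?Z"
    have c: "0 \<le> c"
      using R riesz_partition_pos[of N] by (simp add: c_def)
    have w_eq: "w (x(i := y)) = ennreal c * (ennreal (h y) * ennreal (exp (- V y)))" for y
      using c h_pos[of y] unfolding w_def weight h_def[symmetric]
      by (simp add: c_def flip: ennreal_mult)
    have "(\<integral>\<^sup>+y. w (x(i := y)) * indicator B y \<partial>lborel)
        \<le> (\<integral>\<^sup>+y. ennreal c * (ennreal (exp (- V y)) * indicator B y) \<partial>lborel)"
    proof (rule nn_integral_mono)
      fix y
      have "ennreal (h y) * ennreal (exp (- V y)) \<le> 1 * ennreal (exp (- V y))"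
        using h_le[of y] by (intro mult_right_mono) auto
      then show "w (x(i := y)) * indicator B y \<le> ennreal c * (ennreal (exp (- V y)) * indicator B y)"
        unfolding w_eq by (auto split: split_indicator intro!: mult_left_mono)
    qed
    also have "\<dots> = ennreal c * emeasure gibbs B"
      using B by (simp add: gibbs_def nn_integral_cmult emeasure_density)
    finally have upper: "(\<integral>\<^sup>+y. w (x(i := y)) * indicator B y \<partial>lborel) \<le> ennreal c * emeasure gibbs B" .
    have "real (card J) \<le> real N"
      using card_mono[of "{1..N}" J] by (auto simp: J_def simp del: One_nat_def)
    then have "2 * \<alpha> / real N * real (card J) \<le> 2 * \<alpha>"
      using i \<alpha>_pos by (simp add: field_simps)
    then have "ennreal (exp (- screening \<alpha> s)) \<le> (\<integral>\<^sup>+y. ennreal (h y) * indicator {a..a+1} y \<partial>lborel)"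
      unfolding h_def using \<alpha>_pos s_pos s_less_1 J by (intro nn_integral_boltzmann_ge) auto
    then have "ennreal (exp (- screening \<alpha> s - M)) * ennreal c
        \<le> ennreal c * ennreal (exp (- M)) * (\<integral>\<^sup>+y. ennreal (h y) * indicator {a..a+1} y \<partial>lborel)"
      by (simp add: exp_diff exp_minus divide_inverse ennreal_mult mult_ac mult_left_mono)
    also have "\<dots> = (\<integral>\<^sup>+y. ennreal c * ennreal (exp (- M)) * (ennreal (h y) * indicator {a..a+1} y) \<partial>lborel)"
      by (subst nn_integral_cmult) auto
    also have "\<dots> \<le> (\<integral>\<^sup>+y. w (x(i := y)) * indicator {a..a+1} y \<partial>lborel)"
    proof (rule nn_integral_mono)
      fix y
      show "ennreal c * ennreal (exp (- M)) * (ennreal (h y) * indicator {a..a+1} y)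
        \<le> w (x(i := y)) * indicator {a..a+1} y"
        using V_le[of y] unfolding w_eq
        by (auto split: split_indicator simp: mult_ac intro!: mult_left_mono ennreal_leI)
    qed
    finally have lower: "ennreal (exp (- screening \<alpha> s - M)) * ennreal c
      \<le> (\<integral>\<^sup>+y. w (x(i := y)) * indicator {a..a+1} y \<partial>lborel)" .
    have "ennreal (exp (- screening \<alpha> s - M)) * (\<integral>\<^sup>+y. w (x(i := y)) * indicator B y \<partial>lborel)
        \<le> ennreal (exp (- screening \<alpha> s - M)) * (ennreal c * emeasure gibbs B)"
      using upper by (rule mult_left_mono) simp
    also have "\<dots> = emeasure gibbs B * (ennreal (exp (- screening \<alpha> s - M)) * ennreal c)"
      by (simp add: mult_ac)
    also have "\<dots> \<le> emeasure gibbs B * (\<integral>\<^sup>+y. w (x(i := y)) * indicator {a..a+1} y \<partial>lborel)"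
      using lower by (rule mult_left_mono) simp
    finally show ?thesis .
  qed
  have upd_meas: "(\<lambda>x. \<integral>\<^sup>+y. w (x(i := y)) * indicator B' y \<partial>lborel) \<in> borel_measurable (Pi\<^sub>M J (\<lambda>_. lborel))"
    if [measurable]: "B' \<in> sets borel" for B'
  proof -
    have [measurable]: "w \<in> borel_measurable (Pi\<^sub>M (insert i J) (\<lambda>_. lborel))"
      using w_meas unfolding I .
    show ?thesis by measurable
  qed
  \<comment> \<open>Measurability of \<open>Q\<close> is known on all \<open>N\<close> coordinates
    but needed on \<open>J\<close> alone. Setting coordinate \<open>i\<close> to 0, a value
    \<open>Q\<close> cannot see, transfers it.\<close>
  have Q_meas: "(indicator (Collect Q) :: _ \<Rightarrow> ennreal) \<in> borel_measurable (Pi\<^sub>M J (\<lambda>_. lborel :: real measure))"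
  proof -
    have Q': "Measurable.pred (Pi\<^sub>M (insert i J) (\<lambda>_. lborel)) Q"
      using Q unfolding I .
    have "(\<lambda>x. x(i := 0::real)) \<in> Pi\<^sub>M J (\<lambda>_. lborel) \<rightarrow>\<^sub>M Pi\<^sub>M (insert i J) (\<lambda>_. lborel)"
      by measurable
    from measurable_compose[OF this Q'] have "Measurable.pred (Pi\<^sub>M J (\<lambda>_. lborel :: real measure)) Q"
      by (simp add: Q_upd)
    then show ?thesis by measurable
  qed
  note [measurable] = upd_meas Q_meas
  have "ennreal (exp (- screening \<alpha> s - M)) *
      emeasure (riesz_gas \<alpha> s V N) {x \<in> space (lborel_N N). x i \<in> B \<and> Q x}
    = (\<integral>\<^sup>+x. ennreal (exp (- screening \<alpha> s - M)) * (\<integral>\<^sup>+y. w (x(i := y)) * indicator B y \<partial>lborel)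
        * indicator (Collect Q) x \<partial>Pi\<^sub>M J (\<lambda>_. lborel))"
    unfolding disint[OF B] mult.assoc using upd_meas[OF B] Q_meas
    by (intro nn_integral_cmult[symmetric]) (rule borel_measurable_times_ennreal)
  also have "\<dots> \<le> (\<integral>\<^sup>+x. emeasure gibbs B * (\<integral>\<^sup>+y. w (x(i := y)) * indicator {a..a+1} y \<partial>lborel)
        * indicator (Collect Q) x \<partial>Pi\<^sub>M J (\<lambda>_. lborel))"
    by (intro nn_integral_mono mult_right_mono inner) auto
  also have "\<dots> = emeasure gibbs B * emeasure (riesz_gas \<alpha> s V N) {x \<in> space (lborel_N N). x i \<in> {a..a+1} \<and> Q x}"
    unfolding disint[of "{a..a+1}", OF borel_closed[OF closed_atLeastAtMost]] mult.assoc
    using upd_meas[of "{a..a+1}"] Q_meas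
    by (intro nn_integral_cmult borel_measurable_times_ennreal) auto
  finally show ?thesis .
qed

lemma measure_exchange:
  assumes "i \<in> {1..N}" "B \<in> sets borel" "Measurable.pred (lborel_N N) Q"
    and "\<And>x y. Q (x(i := y)) = Q x" "\<And>y. y \<in> {a..a+1} \<Longrightarrow> V y \<le> M"
  shows "exp (- screening \<alpha> s - M) * measure (riesz_gas \<alpha> s V N) {x \<in> space (lborel_N N). x i \<in> B \<and> Q x}
    \<le> measure gibbs B * measure (riesz_gas \<alpha> s V N) {x \<in> space (lborel_N N). x i \<in> {a..a+1} \<and> Q x}"
proof -
  interpret prob_space "riesz_gas \<alpha> s V N"
    by (rule prob_space_riesz_gas)
  show ?thesis
    using emeasure_exchange[OF assms]
    by (simp add: emeasure_eq_measure gibbs.emeasure_eq_measure flip: ennreal_mult)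
qed

end

subsection \<open>Counting outliers\<close>

text \<open>Double counting: the indicators of the events add up to the number of events that occur.
  The next two lemmas use it to turn a sum of exchange inequalities over the particles into a bound
  for one event, with the multiplicity as a factor.\<close>

lemma (in finite_measure) sum_measure_eq_integral_card:
  assumes "finite I" "\<And>i. i \<in> I \<Longrightarrow> E i \<in> sets M"
  shows "(\<Sum>i\<in>I. measure M (E i)) = (\<integral>x. real (card {i \<in> I. x \<in> E i}) \<partial>M)"
    and "integrable M (\<lambda>x. real (card {i \<in> I. x \<in> E i}))"
proof -
  have eq: "real (card {i \<in> I. x \<in> E i}) = (\<Sum>i\<in>I. indicator (E i) x)" for x
    using assms by (simp add: indicator_def sum.If_cases Int_def)
  have int: "integrable M (indicator (E i) :: 'a \<Rightarrow> real)" if "i \<in> I" for i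
    using assms(2)[OF that] by (simp add: integrable_indicator_iff emeasure_finite less_top[symmetric])
  show "integrable M (\<lambda>x. real (card {i \<in> I. x \<in> E i}))"
    unfolding eq by (intro Bochner_Integration.integrable_sum int)
  show "(\<Sum>i\<in>I. measure M (E i)) = (\<integral>x. real (card {i \<in> I. x \<in> E i}) \<partial>M)"
    unfolding eq by (subst Bochner_Integration.integral_sum) (auto simp: int assms intro!: sum.cong arg_cong[where f = "measure M"] dest: sets.sets_into_space)
qed

lemma (in finite_measure) measure_le_sum_measure:
  assumes "finite I" "\<And>i. i \<in> I \<Longrightarrow> E i \<in> sets M" "S \<in> sets M"
    and "\<And>x. x \<in> S \<Longrightarrow> m \<le> card {i \<in> I. x \<in> E i}"
  shows "real m * measure M S \<le> (\<Sum>i\<in>I. measure M (E i))"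
proof -
  have "real m * measure M S = (\<integral>x. real m * indicator S x \<partial>M)"
    using sets.sets_into_space[OF assms(3)] by (simp add: Int_absorb2)
  also have "\<dots> \<le> (\<integral>x. real (card {i \<in> I. x \<in> E i}) \<partial>M)"
    using assms by (intro integral_mono sum_measure_eq_integral_card integrable_mult_right integrable_real_indicator)
      (auto simp: emeasure_finite less_top[symmetric] split: split_indicator)
  finally show ?thesis
    using sum_measure_eq_integral_card(1)[OF assms(1,2)] by simp
qed

lemma (in finite_measure) sum_measure_le_measure:
  assumes "finite I" "\<And>i. i \<in> I \<Longrightarrow> E i \<in> sets M" "S \<in> sets M"
    and "\<And>i. i \<in> I \<Longrightarrow> E i \<subseteq> S" "\<And>x. x \<in> S \<Longrightarrow> card {i \<in> I. x \<in> E i} \<le> m"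
  shows "(\<Sum>i\<in>I. measure M (E i)) \<le> real m * measure M S"
proof -
  have "real (card {i \<in> I. x \<in> E i}) \<le> real m * indicator S x" for x
  proof (cases "x \<in> S")
    case False
    then have none: "{i \<in> I. x \<in> E i} = {}" using assms(4) by auto
    show ?thesis unfolding none using False by simp
  qed (use assms(5) in auto)
  then have "(\<integral>x. real (card {i \<in> I. x \<in> E i}) \<partial>M) \<le> (\<integral>x. real m * indicator S x \<partial>M)"
    using assms by (intro integral_mono sum_measure_eq_integral_card)
      (auto simp: emeasure_finite less_top[symmetric])
  also have "\<dots> = real m * measure M S"
    using sets.sets_into_space[OF assms(3)] by (simp add: Int_absorb2)
  finally show ?thesis
    using sum_measure_eq_integral_card(1)[OF assms(1,2)] by simp
qed

lemma borel_measurable_lborel_N_component: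
  "i \<in> {1..N} \<Longrightarrow> (\<lambda>x. x i) \<in> borel_measurable (lborel_N N)"
  using measurable_component_singleton[of i "{1..N}" "\<lambda>_. lborel"] by auto

context riesz_ensemble
begin

text \<open>A union bound over the particles, each moved from \<open>B\<close> to
  \<open>[0, 1]\<close> with no condition on the others. The event reached has probability at most
  1.\<close>

lemma measure_exists_le:
  assumes "\<And>y. y \<in> {0..1} \<Longrightarrow> V y \<le> M" "B \<in> sets borel"
  shows "measure (riesz_gas \<alpha> s V N) {x \<in> space (lborel_N N). \<exists>i\<in>{1..N}. x i \<in> B}
    \<le> real N * (exp (screening \<alpha> s + M) * measure gibbs B)"
proof -
  interpret prob_space "riesz_gas \<alpha> s V N"
    by (rule prob_space_riesz_gas)
  let ?E = "\<lambda>i. {x \<in> space (lborel_N N). x i \<in> B}"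
  have E: "?E i \<in> sets (lborel_N N)" if "i \<in> {1..N}" for i
    using borel_measurable_lborel_N_component[OF that] assms(2) by measurable
  have le: "measure (riesz_gas \<alpha> s V N) (?E i) \<le> exp (screening \<alpha> s + M) * measure gibbs B"
    if i: "i \<in> {1..N}" for i
  proof -
    have "exp (- screening \<alpha> s - M) * measure (riesz_gas \<alpha> s V N) {x \<in> space (lborel_N N). x i \<in> B \<and> True}
      \<le> measure gibbs B * measure (riesz_gas \<alpha> s V N) {x \<in> space (lborel_N N). x i \<in> {0..0+1} \<and> True}"
      using assms i by (intro measure_exchange) auto
    also have "\<dots> \<le> measure gibbs B * 1"
      by (intro mult_left_mono prob_le_1) auto
    finally have "exp (screening \<alpha> s + M) * (exp (- screening \<alpha> s - M) * measure (riesz_gas \<alpha> s V N) (?E i))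
      \<le> exp (screening \<alpha> s + M) * measure gibbs B"
      by (intro mult_left_mono) auto
    then show ?thesis
      by (simp flip: exp_add mult.assoc)
  qed
  have "{x \<in> space (lborel_N N). \<exists>i\<in>{1..N}. x i \<in> B} = (\<Union>i\<in>{1..N}. ?E i)"
    by blast
  then have "measure (riesz_gas \<alpha> s V N) {x \<in> space (lborel_N N). \<exists>i\<in>{1..N}. x i \<in> B}
      \<le> (\<Sum>i\<in>{1..N}. measure (riesz_gas \<alpha> s V N) (?E i))"
    using E by (auto intro!: finite_measure_subadditive_finite simp del: One_nat_def)
  also have "\<dots> \<le> (\<Sum>i\<in>{1..N}. exp (screening \<alpha> s + M) * measure gibbs B)"
    using le by (rule sum_mono)
  finally show ?thesis by simp
qed

text \<open>From a configuration below \<open>b\<close>, any of the \<open>N\<close> particles may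
  be moved to \<open>{a..a+1}\<close>. Since \<open>b < a\<close>, the moved particle can be
  recognised afterwards, so the \<open>N\<close> resulting events are disjoint and the full factor
  \<open>N\<close> is gained.\<close>

lemma measure_one_outlier_ge:
  assumes "\<And>y. y \<in> {a..a+1} \<Longrightarrow> V y \<le> M" "b < a"
  shows "real N * (exp (- screening \<alpha> s - M) *
      measure (riesz_gas \<alpha> s V N) {x \<in> space (lborel_N N). \<forall>i\<in>{1..N}. x i \<le> b})
    \<le> measure gibbs UNIV * measure (riesz_gas \<alpha> s V N)
        {x \<in> space (lborel_N N). \<exists>i\<in>{1..N}. x i \<in> {a..a+1} \<and> (\<forall>j\<in>{1..N}-{i}. x j \<le> b)}"
proof -
  interpret prob_space "riesz_gas \<alpha> s V N"
    by (rule prob_space_riesz_gas)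
  note comp [measurable] = borel_measurable_lborel_N_component
  let ?P = "measure (riesz_gas \<alpha> s V N)"
  define Q where "Q i x \<longleftrightarrow> (\<forall>j\<in>{1..N}-{i}. x j \<le> b)" for i :: nat and x :: "nat \<Rightarrow> real"
  have Q_meas [measurable]: "Measurable.pred (lborel_N N) (Q i)" for i
    unfolding Q_def by measurable
  let ?E = "\<lambda>i. {x \<in> space (lborel_N N). x i \<in> {a..a+1} \<and> Q i x}"
  have E: "?E i \<in> sets (lborel_N N)" if "i \<in> {1..N}" for i
    using comp[OF that] by measurable
  have step: "exp (- screening \<alpha> s - M) * ?P {x \<in> space (lborel_N N). \<forall>i\<in>{1..N}. x i \<le> b}
      \<le> measure gibbs UNIV * ?P (?E i)" if i: "i \<in> {1..N}" for i
  proof -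
    have "{x \<in> space (lborel_N N). \<forall>i\<in>{1..N}. x i \<le> b} = {x \<in> space (lborel_N N). x i \<in> {..b} \<and> Q i x}"
      using i by (auto simp: Q_def)
    then have "exp (- screening \<alpha> s - M) * ?P {x \<in> space (lborel_N N). \<forall>i\<in>{1..N}. x i \<le> b}
        \<le> measure gibbs {..b} * ?P (?E i)"
      using assms i by (simp only:) (intro measure_exchange; auto simp: Q_def simp del: One_nat_def)
    also have "\<dots> \<le> measure gibbs UNIV * ?P (?E i)"
      by (intro mult_right_mono gibbs.finite_measure_mono) auto
    finally show ?thesis .
  qed
  have card_le: "card {i \<in> {1..N}. x \<in> ?E i} \<le> 1" for x
  proof -
    have "i = j" if "i \<in> {1..N}" "j \<in> {1..N}" "x \<in> ?E i" "x \<in> ?E j" for i j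
      using that assms(2) by (force simp: Q_def)
    then show ?thesis
      by (intro card_le_Suc0_iff_eq[THEN iffD2, simplified One_nat_def[symmetric]]) auto
  qed
  have "real N * (exp (- screening \<alpha> s - M) * ?P {x \<in> space (lborel_N N). \<forall>i\<in>{1..N}. x i \<le> b})
      \<le> (\<Sum>i\<in>{1..N}. measure gibbs UNIV * ?P (?E i))"
    using sum_mono[OF step, of "{1..N}"] by simp
  also have "\<dots> = measure gibbs UNIV * (\<Sum>i\<in>{1..N}. ?P (?E i))"
    by (simp add: sum_distrib_left)
  also have "(\<Sum>i\<in>{1..N}. ?P (?E i)) \<le> real 1 * ?P {x \<in> space (lborel_N N). \<exists>i\<in>{1..N}. x i \<in> {a..a+1} \<and> Q i x}"
  proof (rule sum_measure_le_measure)
    have "{x \<in> space (lborel_N N). \<exists>i\<in>{1..N}. x i \<in> {a..a+1} \<and> Q i x} = (\<Union>i\<in>{1..N}. ?E i)"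
      by blast
    then show "{x \<in> space (lborel_N N). \<exists>i\<in>{1..N}. x i \<in> {a..a+1} \<and> Q i x} \<in> sets (riesz_gas \<alpha> s V N)"
      using E by (simp only:) (intro sets.finite_UN; simp del: One_nat_def)
  next
    show "card {i \<in> {1..N}. x \<in> ?E i} \<le> 1" for x
      by (rule card_le)
  qed (use E in \<open>auto simp del: One_nat_def\<close>)
  finally show ?thesis
    by (simp add: Q_def mult_left_mono)
qed

text \<open>The inequality is non-strict so that any particle placed in \<open>{t..t+1}\<close> is
  counted, and so that \<open>k = 0\<close> means that all particles are strictly below
  \<open>t\<close>.\<close>

definition count_above :: "nat \<Rightarrow> real \<Rightarrow> nat \<Rightarrow> (nat \<Rightarrow> real) set" where
  "count_above N t k = {x \<in> space (lborel_N N). card {i \<in> {1..N}. t \<le> x i} = k}"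

text \<open>With \<open>k\<close> particles above \<open>t\<close>, each of the other
  \<open>N - k\<close> can be lifted into \<open>{t..t+1}\<close>. A configuration with
  \<open>Suc k\<close> particles above arises from at most \<open>Suc k\<close> choices of the
  lifted one.\<close>

lemma measure_count_above_step:
  assumes "\<And>y. y \<in> {t..t+1} \<Longrightarrow> V y \<le> M"
  shows "real (N - k) * (exp (- screening \<alpha> s - M) * measure (riesz_gas \<alpha> s V N) (count_above N t k))
    \<le> measure gibbs UNIV * (real (Suc k) * measure (riesz_gas \<alpha> s V N) (count_above N t (Suc k)))"
proof -
  interpret prob_space "riesz_gas \<alpha> s V N"
    by (rule prob_space_riesz_gas)
  note comp [measurable] = borel_measurable_lborel_N_component
  let ?P = "measure (riesz_gas \<alpha> s V N)"
  have card_meas: "Measurable.pred (lborel_N N) (\<lambda>x. card {j \<in> J. t \<le> x j} = m)" if "J \<subseteq> {1..N}" for J m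
  proof -
    have "(\<lambda>x. card {j \<in> J. t \<le> x j}) \<in> lborel_N N \<rightarrow>\<^sub>M count_space UNIV"
    proof (rule measurable_card)
      fix j
      show "{x \<in> space (lborel_N N). j \<in> {j \<in> J. t \<le> x j}} \<in> sets (lborel_N N)"
        using comp[of j N] that by (cases "j \<in> J") (auto simp del: One_nat_def)
    qed
    then show ?thesis by measurable
  qed
  have A: "count_above N t m \<in> sets (riesz_gas \<alpha> s V N)" for m
    unfolding count_above_def using card_meas[of "{1..N}" m] by measurable
  \<comment> \<open>The count omits \<open>i\<close>, so the same condition means \<open>k\<close>
    particles above when \<open>i\<close> is below \<open>t\<close> and \<open>Suc k\<close> when it
    is above.\<close>
  define Q where "Q i x \<longleftrightarrow> card {j \<in> {1..N} - {i}. t \<le> x j} = k" for i :: nat and x :: "nat \<Rightarrow> real"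
  have Q_meas [measurable]: "Measurable.pred (lborel_N N) (Q i)" for i
    unfolding Q_def by (rule card_meas) auto
  have Q_upd: "Q i (x(i := y)) = Q i x" for i x y
  proof -
    have "{j \<in> {1..N} - {i}. t \<le> (x(i := y)) j} = {j \<in> {1..N} - {i}. t \<le> x j}" by auto
    then show ?thesis by (simp add: Q_def)
  qed
  let ?B = "\<lambda>i. {x \<in> space (lborel_N N). x i \<in> {..<t} \<and> Q i x}"
  let ?E = "\<lambda>i. {x \<in> space (lborel_N N). x i \<in> {t..t+1} \<and> Q i x}"
  have BE: "?B i \<in> sets (riesz_gas \<alpha> s V N)" "?E i \<in> sets (riesz_gas \<alpha> s V N)" if "i \<in> {1..N}" for i
    using comp[OF that] by measurable
  have "real (N - k) * ?P (count_above N t k) \<le> (\<Sum>i\<in>{1..N}. ?P (?B i))"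
  proof (rule measure_le_sum_measure)
    fix x assume x: "x \<in> count_above N t k"
    have "Q i x" if "i \<in> {1..N}" "x i < t" for i
    proof -
      have "{j \<in> {1..N} - {i}. t \<le> x j} = {j \<in> {1..N}. t \<le> x j}" using that by auto
      then show ?thesis using x by (simp add: Q_def count_above_def)
    qed
    then have "{1..N} - {j \<in> {1..N}. t \<le> x j} \<subseteq> {i \<in> {1..N}. x \<in> ?B i}"
      using x by (auto simp: count_above_def)
    then have "card ({1..N} - {j \<in> {1..N}. t \<le> x j}) \<le> card {i \<in> {1..N}. x \<in> ?B i}"
      by (intro card_mono) auto
    moreover have "card ({1..N} - {j \<in> {1..N}. t \<le> x j}) = N - k"
      using x by (subst card_Diff_subset) (auto simp: count_above_def)
    ultimately show "N - k \<le> card {i \<in> {1..N}. x \<in> ?B i}" by simp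
  qed (use A BE in auto)
  then have "real (N - k) * (exp (- screening \<alpha> s - M) * ?P (count_above N t k))
      \<le> (\<Sum>i\<in>{1..N}. exp (- screening \<alpha> s - M) * ?P (?B i))"
    by (simp flip: sum_distrib_left)
  also have "\<dots> \<le> (\<Sum>i\<in>{1..N}. measure gibbs {..<t} * ?P (?E i))"
    using assms Q_upd Q_meas by (intro sum_mono measure_exchange) (auto simp del: One_nat_def)
  also have "\<dots> \<le> (\<Sum>i\<in>{1..N}. measure gibbs UNIV * ?P (?E i))"
    by (intro sum_mono mult_right_mono gibbs.finite_measure_mono) auto
  also have "\<dots> = measure gibbs UNIV * (\<Sum>i\<in>{1..N}. ?P (?E i))"
    by (simp add: sum_distrib_left)
  also have "\<dots> \<le> measure gibbs UNIV * (real (Suc k) * ?P (count_above N t (Suc k)))"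
  proof (intro mult_left_mono sum_measure_le_measure)
    fix i assume i: "i \<in> {1..N}"
    show "?E i \<subseteq> count_above N t (Suc k)"
    proof
      fix x assume x: "x \<in> ?E i"
      have "{j \<in> {1..N}. t \<le> x j} = insert i {j \<in> {1..N} - {i}. t \<le> x j}"
        using x i by auto
      then have "card {j \<in> {1..N}. t \<le> x j} = Suc (card {j \<in> {1..N} - {i}. t \<le> x j})"
        by simp
      then show "x \<in> count_above N t (Suc k)"
        using x by (auto simp: count_above_def Q_def)
    qed
  next
    fix x assume x: "x \<in> count_above N t (Suc k)"
    have "card {i \<in> {1..N}. x \<in> ?E i} \<le> card {i \<in> {1..N}. t \<le> x i}"
      by (intro card_mono) auto
    then show "card {i \<in> {1..N}. x \<in> ?E i} \<le> Suc k"
      using x by (simp add: count_above_def)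
  qed (use A BE in auto)
  finally show ?thesis .
qed

text \<open>The step is iterated from 0 to \<open>k\<close>. By \<open>2 * k \<le> N\<close> at
  least half of the particles are still available each time, which gives the factor 2; the
  multiplicities \<open>Suc m\<close> multiply to \<open>fact k\<close>.\<close>

lemma measure_all_below_le:
  assumes "\<And>y. y \<in> {t..t+1} \<Longrightarrow> V y \<le> M" "2 * k \<le> N" "0 < N"
  shows "measure (riesz_gas \<alpha> s V N) {x \<in> space (lborel_N N). \<forall>i\<in>{1..N}. x i < t}
    \<le> fact k * (2 * measure gibbs UNIV * exp (screening \<alpha> s + M) / real N) ^ k"
proof -
  interpret prob_space "riesz_gas \<alpha> s V N"
    by (rule prob_space_riesz_gas)
  let ?P = "\<lambda>m. measure (riesz_gas \<alpha> s V N) (count_above N t m)"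
  define r where "r = 2 * measure gibbs UNIV * exp (screening \<alpha> s + M) / real N"
  have r: "0 \<le> r" by (simp add: r_def)
  have step: "?P m \<le> real (Suc m) * r * ?P (Suc m)" if "m < k" for m
  proof -
    have "real N / 2 * (exp (- screening \<alpha> s - M) * ?P m) \<le> real (N - m) * (exp (- screening \<alpha> s - M) * ?P m)"
      using that assms(2) by (intro mult_right_mono) auto
    also have "\<dots> \<le> measure gibbs UNIV * (real (Suc m) * ?P (Suc m))"
      by (rule measure_count_above_step) (rule assms)
    finally have "(2 * exp (screening \<alpha> s + M) / real N) * (real N / 2 * (exp (- screening \<alpha> s - M) * ?P m))
      \<le> (2 * exp (screening \<alpha> s + M) / real N) * (measure gibbs UNIV * (real (Suc m) * ?P (Suc m)))"
      by (intro mult_left_mono) auto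
    moreover have "(2 * exp (screening \<alpha> s + M) / real N) * (real N / 2 * (exp (- screening \<alpha> s - M) * ?P m))
        = exp (screening \<alpha> s + M) * exp (- screening \<alpha> s - M) * ?P m"
      using assms(3) by simp
    moreover have "exp (screening \<alpha> s + M) * exp (- screening \<alpha> s - M) = 1"
      by (simp flip: exp_add)
    moreover have "(2 * exp (screening \<alpha> s + M) / real N) * (measure gibbs UNIV * (real (Suc m) * ?P (Suc m)))
        = real (Suc m) * r * ?P (Suc m)"
      by (simp add: r_def mult_ac)
    ultimately show ?thesis by simp
  qed
  have "?P 0 \<le> fact m * r ^ m * ?P m" if "m \<le> k" for m
    using that
  proof (induction m)
    case (Suc m)
    have "?P 0 \<le> fact m * r ^ m * ?P m" using Suc by simp
    also have "\<dots> \<le> fact m * r ^ m * (real (Suc m) * r * ?P (Suc m))"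
      using step[of m] Suc.prems r by (intro mult_left_mono) auto
    also have "\<dots> = fact (Suc m) * r ^ Suc m * ?P (Suc m)"
      by (simp add: mult_ac)
    finally show ?case .
  qed simp
  from this[of k] have "?P 0 \<le> fact k * r ^ k * ?P k" by simp
  also have "\<dots> \<le> fact k * r ^ k * 1"
    using r by (intro mult_left_mono prob_le_1) auto
  also have "count_above N t 0 = {x \<in> space (lborel_N N). \<forall>i\<in>{1..N}. x i < t}"
  proof -
    have "card {i \<in> {1..N}. t \<le> x i} = 0 \<longleftrightarrow> {i \<in> {1..N}. t \<le> x i} = {}" for x :: "nat \<Rightarrow> real"
      by (rule card_0_eq) simp
    moreover have "{i \<in> {1..N}. t \<le> x i} = {} \<longleftrightarrow> (\<forall>i\<in>{1..N}. x i < t)" for x :: "nat \<Rightarrow> real"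
      using not_le by blast
    ultimately show ?thesis by (simp only: count_above_def)
  qed
  finally show ?thesis by (simp add: r_def)
qed

end

subsection \<open>Growth of the potential and logarithmic asymptotics\<close>

text \<open>Domination by the exponential density plus its reflection, divided by \<open>e\<close>.
  At 0 both summands contribute, hence a bound and not an equality.\<close>

lemma integrable_exp_neg_abs:
  assumes "0 < (e::real)"
  shows "integrable lborel (\<lambda>y. exp (- e * \<bar>y\<bar>))"
proof (rule Bochner_Integration.integrable_bound)
  interpret prob_space "density lborel (exponential_density e)"
    using assms by (rule prob_space_exponential_density)
  have "(\<integral>\<^sup>+y. ennreal (exponential_density e y) \<partial>lborel) = 1"
    using emeasure_space_1 by (simp add: emeasure_density)
  then have ed: "integrable lborel (exponential_density e)"
    using assms by (intro integrableI_nonneg) (auto simp: exponential_density_nonneg)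
  then have "integrable lborel (\<lambda>y. exponential_density e (0 + (-1) * y))"
    by (subst lborel_integrable_real_affine_iff) auto
  with ed show "integrable lborel (\<lambda>y. (exponential_density e y + exponential_density e (0 + (-1) * y)) / e)"
    by auto
  show "AE y in lborel. norm (exp (- e * \<bar>y\<bar>)) \<le>
      norm ((exponential_density e y + exponential_density e (0 + (-1) * y)) / e)"
    using assms by (intro AE_I2) (auto simp: exponential_density_def field_simps abs_if)
qed measurable

lemma continuous_bounded_on_cball:
  fixes f :: "real \<Rightarrow> real"
  assumes "continuous_on UNIV f"
  obtains C where "\<And>y. \<bar>y\<bar> \<le> R \<Longrightarrow> \<bar>f y\<bar> \<le> C"
proof -
  have "compact (f ` {-R..R})"
    using assms by (intro compact_continuous_image continuous_on_subset[OF assms]) auto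
  then obtain C where "\<forall>x\<in>f ` {-R..R}. norm x \<le> C"
    using compact_imp_bounded bounded_iff by metis
  then show ?thesis by (intro that[of C]) (auto simp: abs_le_iff)
qed

text \<open>The little-o condition with constant \<open>\<epsilon>\<close>. Taking \<open>R\<close>
  at least 1 ensures \<open>\<bar>y\<bar> \<le> \<bar>y\<bar> powr d\<close> beyond \<open>R\<close>
  when \<open>d\<close> is at least 1.\<close>

lemma admissible_potential_eventually:
  assumes "admissible_potential V \<theta> d" "0 < \<epsilon>"
  obtains R where "1 \<le> R" "\<And>y. R \<le> \<bar>y\<bar> \<Longrightarrow> \<bar>V y - \<theta> * \<bar>y\<bar> powr d\<bar> \<le> \<epsilon> * \<bar>y\<bar> powr d"
proof -
  from assms(1) obtain \<phi> where V: "\<And>x. V x = \<theta> * \<bar>x\<bar> powr d + \<phi> x"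
    and \<phi>: "\<phi> \<in> o[at_infinity](\<lambda>x. \<bar>x\<bar> powr d)"
    unfolding admissible_potential_def by blast
  from landau_o.smallD[OF \<phi> assms(2)] obtain R where R: "\<And>x. R \<le> \<bar>x\<bar> \<Longrightarrow> \<bar>\<phi> x\<bar> \<le> \<epsilon> * \<bar>x\<bar> powr d"
    unfolding eventually_at_infinity by auto
  show ?thesis
    by (rule that[of "max 1 R"]) (use R V in auto)
qed

text \<open>Half of the gap \<open>\<theta> - \<eta>\<close> absorbs the perturbation; the other
  half leaves a linear term, which later provides an integrable factor beside the decay
  \<open>exp (- \<eta> * t powr d)\<close>.\<close>

lemma admissible_potential_ge:
  assumes V: "admissible_potential V \<theta> d" and "1 \<le> d" "0 < \<eta>" "\<eta> < \<theta>"
  obtains C where "\<And>y. \<eta> * \<bar>y\<bar> powr d + (\<theta> - \<eta>) / 2 * \<bar>y\<bar> - C \<le> V y"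
proof -
  have cont: "continuous_on UNIV V"
    using V by (simp add: admissible_potential_def)
  obtain R where R: "1 \<le> R" "\<And>y. R \<le> \<bar>y\<bar> \<Longrightarrow> \<bar>V y - \<theta> * \<bar>y\<bar> powr d\<bar> \<le> (\<theta> - \<eta>) / 2 * \<bar>y\<bar> powr d"
    using admissible_potential_eventually[OF V, of "(\<theta> - \<eta>) / 2"] assms by auto
  obtain C where C: "\<And>y. \<bar>y\<bar> \<le> R \<Longrightarrow> \<bar>V y\<bar> \<le> C"
    using continuous_bounded_on_cball[OF cont] by blast
  have C0: "0 \<le> C" using C[of 0] R(1) by auto
  show ?thesis
  \<comment> \<open>For \<open>\<bar>y\<bar> \<le> R\<close> the two growth terms are at most their
    values at \<open>R\<close>, and \<open>V\<close> is at least \<open>- C\<close>.\<close>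
  proof (rule that[of "C + \<eta> * R powr d + (\<theta> - \<eta>) / 2 * R"])
    fix y :: real
    show "\<eta> * \<bar>y\<bar> powr d + (\<theta> - \<eta>) / 2 * \<bar>y\<bar> - (C + \<eta> * R powr d + (\<theta> - \<eta>) / 2 * R) \<le> V y"
    proof (cases "\<bar>y\<bar> \<le> R")
      case True
      have "\<eta> * \<bar>y\<bar> powr d \<le> \<eta> * R powr d"
        using True assms by (intro mult_left_mono powr_mono2) auto
      moreover have "(\<theta> - \<eta>) / 2 * \<bar>y\<bar> \<le> (\<theta> - \<eta>) / 2 * R"
        using True assms by (intro mult_left_mono) auto
      ultimately show ?thesis using C[OF True] by linarith
    next
      case False
      then have y: "1 \<le> \<bar>y\<bar>" using R(1) by auto
      have "\<bar>y\<bar> powr 1 \<le> \<bar>y\<bar> powr d"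
        using y assms by (intro powr_mono) auto
      then have "(\<theta> - \<eta>) / 2 * \<bar>y\<bar> \<le> (\<theta> - \<eta>) / 2 * \<bar>y\<bar> powr d"
        using y assms by (intro mult_left_mono) auto
      moreover have "0 \<le> \<eta> * R powr d" "0 \<le> (\<theta> - \<eta>) / 2 * R"
        using assms R(1) by auto
      moreover have "\<theta> * \<bar>y\<bar> powr d = \<eta> * \<bar>y\<bar> powr d + 2 * ((\<theta> - \<eta>) / 2 * \<bar>y\<bar> powr d)"
        by (simp add: field_simps)
      ultimately show ?thesis using R(2)[of y] False C0 by linarith
    qed
  qed
qed

lemma admissible_potential_le:
  assumes V: "admissible_potential V \<theta> d" and "0 < \<theta>" "\<theta> < \<eta>"
  obtains C where "\<And>y. V y \<le> \<eta> * \<bar>y\<bar> powr d + C"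
proof -
  have cont: "continuous_on UNIV V"
    using V by (simp add: admissible_potential_def)
  obtain R where R: "1 \<le> R" "\<And>y. R \<le> \<bar>y\<bar> \<Longrightarrow> \<bar>V y - \<theta> * \<bar>y\<bar> powr d\<bar> \<le> (\<eta> - \<theta>) * \<bar>y\<bar> powr d"
    using admissible_potential_eventually[OF V, of "\<eta> - \<theta>"] assms by auto
  obtain C where C: "\<And>y. \<bar>y\<bar> \<le> R \<Longrightarrow> \<bar>V y\<bar> \<le> C"
    using continuous_bounded_on_cball[OF cont] by blast
  have C0: "0 \<le> C" using C[of 0] R(1) by auto
  show ?thesis
  proof (rule that[of C])
    fix y :: real
    show "V y \<le> \<eta> * \<bar>y\<bar> powr d + C"
    proof (cases "\<bar>y\<bar> \<le> R")
      case True
      have "0 \<le> \<eta> * \<bar>y\<bar> powr d" using assms by simp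
      then show ?thesis using C[OF True] by linarith
    next
      case False
      then have "\<bar>V y - \<theta> * \<bar>y\<bar> powr d\<bar> \<le> (\<eta> - \<theta>) * \<bar>y\<bar> powr d"
        using R(2) by simp
      moreover have "\<eta> * \<bar>y\<bar> powr d = \<theta> * \<bar>y\<bar> powr d + (\<eta> - \<theta>) * \<bar>y\<bar> powr d"
        by (simp add: algebra_simps)
      ultimately show ?thesis using C0 by linarith
    qed
  qed
qed

section \<open>From power bounds in \<open>N\<close> to logarithmic limits\<close>

text \<open>A constant prefactor contributes \<open>ln C / ln N\<close>, which tends to 0. A
  vanishing probability has logarithm minus infinity and satisfies the bound trivially.\<close>

lemma limsup_log_prob_le:
  assumes "eventually (\<lambda>N. 0 \<le> p N \<and> p N \<le> C * exp (e * ln (real N))) sequentially" "0 < C"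
  shows "limsup (\<lambda>N. ereal (1 / ln (real N)) * log_prob (p N)) \<le> ereal e"
proof -
  have "limsup (\<lambda>N. ereal (1 / ln (real N)) * log_prob (p N)) \<le> limsup (\<lambda>N. ereal (ln C / ln (real N) + e))"
  proof (rule Limsup_mono)
    show "\<forall>\<^sub>F N in sequentially. ereal (1 / ln (real N)) * log_prob (p N) \<le> ereal (ln C / ln (real N) + e)"
      using assms(1) eventually_gt_at_top[of 1]
    proof eventually_elim
      case (elim N)
      then have pos: "0 < ln (real N)" by simp
      show ?case
      proof (cases "p N = 0")
        case True
        then show ?thesis using pos by (simp add: log_prob_def)
      next
        case False
        then have "ln (p N) \<le> ln (C * exp (e * ln (real N)))"
          using elim assms(2) by (subst ln_le_cancel_iff) auto
        also have "\<dots> = ln C + e * ln (real N)"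
          using assms(2) by (simp add: ln_mult)
        finally have "ln (p N) / ln (real N) \<le> (ln C + e * ln (real N)) / ln (real N)"
          using pos by (intro divide_right_mono) auto
        then show ?thesis using False pos by (simp add: log_prob_def add_divide_distrib)
      qed
    qed
  qed
  also have "limsup (\<lambda>N. ereal (ln C / ln (real N) + e)) = ereal e"
  proof (rule lim_imp_Limsup)
    have "(\<lambda>N. ln C / ln (real N) + e) \<longlonglongrightarrow> e" by real_asymp
    then show "(\<lambda>N. ereal (ln C / ln (real N) + e)) \<longlonglongrightarrow> ereal e" by simp
  qed simp
  finally show ?thesis .
qed

lemma liminf_log_prob_ge:
  assumes "eventually (\<lambda>N. C * exp (e * ln (real N)) \<le> p N) sequentially" "0 < C"
  shows "ereal e \<le> liminf (\<lambda>N. ereal (1 / ln (real N)) * log_prob (p N))"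
proof -
  have "ereal e = liminf (\<lambda>N. ereal (ln C / ln (real N) + e))"
  proof (rule lim_imp_Liminf[symmetric])
    have "(\<lambda>N. ln C / ln (real N) + e) \<longlonglongrightarrow> e" by real_asymp
    then show "(\<lambda>N. ereal (ln C / ln (real N) + e)) \<longlonglongrightarrow> ereal e" by simp
  qed simp
  also have "\<dots> \<le> liminf (\<lambda>N. ereal (1 / ln (real N)) * log_prob (p N))"
  proof (rule Liminf_mono)
    show "\<forall>\<^sub>F N in sequentially. ereal (ln C / ln (real N) + e) \<le> ereal (1 / ln (real N)) * log_prob (p N)"
      using assms(1) eventually_gt_at_top[of 1]
    proof eventually_elim
      case (elim N)
      then have pos: "0 < ln (real N)" by simp
      have p: "0 < C * exp (e * ln (real N))" using assms(2) by simp
      have "ln C + e * ln (real N) = ln (C * exp (e * ln (real N)))"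
        using assms(2) by (simp add: ln_mult)
      also have "\<dots> \<le> ln (p N)"
        using p elim by (subst ln_le_cancel_iff) auto
      finally have "(ln C + e * ln (real N)) / ln (real N) \<le> ln (p N) / ln (real N)"
        using pos by (intro divide_right_mono) auto
      then show ?case using p elim pos by (simp add: log_prob_def add_divide_distrib)
    qed
  qed
  finally show ?thesis .
qed

lemma log_prob_mono: "0 \<le> p \<Longrightarrow> p \<le> q \<Longrightarrow> log_prob p \<le> log_prob q"
  by (auto simp: log_prob_def)

text \<open>A monotone function has a right limit at 0, namely its infimum over positive arguments,
  which always exists in \<open>ereal\<close>. This supplies the limit of the window probabilities
  as \<open>\<delta>\<close> tends to 0.\<close>

lemma mono_at_right_zero_limit:
  fixes f :: "real \<Rightarrow> ereal"
  assumes mono: "\<And>a b. 0 < a \<Longrightarrow> a \<le> b \<Longrightarrow> f a \<le> f b"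
    and lower: "\<And>a. 0 < a \<Longrightarrow> l \<le> f a"
  shows "\<exists>L. (f \<longlongrightarrow> L) (at_right 0) \<and> l \<le> L"
proof (intro exI conjI)
  show "(f \<longlongrightarrow> (INF a\<in>{0<..}. f a)) (at_right 0)"
  proof (rule order_tendstoI)
    fix y assume "y < (INF a\<in>{0<..}. f a)"
    then have "\<And>a. 0 < a \<Longrightarrow> y < f a" by (auto dest: less_INF_D)
    then show "\<forall>\<^sub>F a in at_right 0. y < f a"
      by (auto simp: eventually_at_right_less intro: eventually_mono[OF eventually_at_right_less])
  next
    fix y assume "(INF a\<in>{0<..}. f a) < y"
    then obtain b where b: "0 < b" "f b < y" by (auto simp: INF_less_iff)
    have "\<forall>\<^sub>F a in at_right 0. a \<in> {0<..<b}"
      by (rule eventually_at_right_real) (rule b)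
    then show "\<forall>\<^sub>F a in at_right 0. f a < y"
    proof eventually_elim
      case (elim a)
      then show ?case using mono[of a b] b by auto
    qed
  qed
  show "l \<le> (INF a\<in>{0<..}. f a)"
    using lower by (intro INF_greatest) auto
qed

subsection \<open>Position of the rightmost particle\<close>

locale confined_riesz_ensemble =
  fixes \<alpha> s \<theta> d :: real and V :: "real \<Rightarrow> real"
  assumes interaction: "0 < \<alpha>" "0 < s" "s < 1" and d_ge_1: "1 \<le> d" and theta_pos: "0 < \<theta>"
    and admissible: "admissible_potential V \<theta> d"
begin

lemma continuous_V: "continuous_on UNIV V"
  using admissible by (simp add: admissible_potential_def)

sublocale riesz_ensemble \<alpha> s V
proof
  show [measurable]: "V \<in> borel_measurable borel"
    using continuous_V by (rule borel_measurable_continuous_onI)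
  \<comment> \<open>With \<open>\<eta> = \<theta> / 2\<close> the linear term has slope
    \<open>\<theta> / 4\<close>, the rate of the dominating exponential below.\<close>
  obtain C where C: "\<And>y. \<theta> / 2 * \<bar>y\<bar> powr d + (\<theta> - \<theta> / 2) / 2 * \<bar>y\<bar> - C \<le> V y"
    using admissible_potential_ge[OF admissible d_ge_1, of "\<theta> / 2"] theta_pos by auto
  show "integrable lborel (\<lambda>y. exp (- V y))"
  proof (rule Bochner_Integration.integrable_bound)
    show "integrable lborel (\<lambda>y. exp C * exp (- (\<theta> / 4) * \<bar>y\<bar>))"
      using theta_pos by (intro integrable_mult_right integrable_exp_neg_abs) auto
    show "AE y in lborel. norm (exp (- V y)) \<le> norm (exp C * exp (- (\<theta> / 4) * \<bar>y\<bar>))"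
    proof (rule AE_I2)
      fix y :: real
      have "0 \<le> \<theta> / 2 * \<bar>y\<bar> powr d" using theta_pos by simp
      then have "- V y \<le> C + - (\<theta> / 4) * \<bar>y\<bar>" using C[of y] by simp
      then show "norm (exp (- V y)) \<le> norm (exp C * exp (- (\<theta> / 4) * \<bar>y\<bar>))"
        by (simp flip: exp_add)
    qed
  qed measurable
qed (fact interaction)+

text \<open>On \<open>{t<..}\<close> the power term of the lower bound for \<open>V\<close> is at
  least its value at \<open>t\<close> and comes out of the integral; the remaining linear term is
  integrable.\<close>

lemma gibbs_tail:
  assumes "0 < \<eta>" "\<eta> < \<theta>"
  obtains C where "0 < C" "\<And>t. 0 \<le> t \<Longrightarrow> measure gibbs {t<..} \<le> C * exp (- \<eta> * t powr d)"
proof -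
  obtain C where C: "\<And>y. \<eta> * \<bar>y\<bar> powr d + (\<theta> - \<eta>) / 2 * \<bar>y\<bar> - C \<le> V y"
    using admissible_potential_ge[OF admissible d_ge_1 assms] by blast
  define f where "f y = exp (- ((\<theta> - \<eta>) / 2) * \<bar>y\<bar>)" for y :: real
  have f: "integrable lborel f"
    unfolding f_def using assms by (intro integrable_exp_neg_abs) auto
  have f_meas [measurable]: "f \<in> borel_measurable borel"
    unfolding f_def by measurable
  define F where "F = (\<integral>y. f y \<partial>lborel)"
  have f_nonneg: "0 \<le> f y" for y
    by (simp add: f_def)
  then have F: "0 \<le> F" "(\<integral>\<^sup>+y. ennreal (f y) \<partial>lborel) = ennreal F"
    unfolding F_def using nn_integral_eq_integral[OF f] by auto
  show ?thesis
  \<comment> \<open>\<open>F + 1\<close> instead of \<open>F\<close> makes the constant visibly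
    positive.\<close>
  proof (rule that[of "exp C * (F + 1)"])
    show "0 < exp C * (F + 1)" using F by simp
    fix t :: real assume t: "0 \<le> t"
    define c where "c = exp C * exp (- \<eta> * t powr d)"
    have c: "0 \<le> c" by (simp add: c_def)
    have "ennreal (measure gibbs {t<..}) = (\<integral>\<^sup>+y. ennreal (exp (- V y)) * indicator {t<..} y \<partial>lborel)"
      unfolding gibbs.emeasure_eq_measure[symmetric] by (simp add: gibbs_def emeasure_density)
    also have "\<dots> \<le> (\<integral>\<^sup>+y. ennreal c * ennreal (f y) \<partial>lborel)"
    proof (rule nn_integral_mono)
      fix y
      have "exp (- V y) \<le> c * f y" if "t < y"
      proof -
        have "\<eta> * t powr d \<le> \<eta> * \<bar>y\<bar> powr d"
          using that t assms d_ge_1 by (intro mult_left_mono powr_mono2) auto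
        then have "- V y \<le> C + - \<eta> * t powr d + - ((\<theta> - \<eta>) / 2) * \<bar>y\<bar>"
          using C[of y] by simp
        then have "exp (- V y) \<le> exp (C + - \<eta> * t powr d + - ((\<theta> - \<eta>) / 2) * \<bar>y\<bar>)"
          by (simp only: exp_le_cancel_iff)
        then show ?thesis by (simp only: c_def f_def exp_add)
      qed
      then show "ennreal (exp (- V y)) * indicator {t<..} y \<le> ennreal c * ennreal (f y)"
        using c by (auto split: split_indicator simp: f_def simp flip: ennreal_mult intro!: ennreal_leI)
    qed
    also have "\<dots> = ennreal (c * F)"
      using c F by (simp add: nn_integral_cmult ennreal_mult)
    finally have "measure gibbs {t<..} \<le> c * F"
      using c F by simp
    also have "\<dots> \<le> c * (F + 1)"
      using c by (intro mult_left_mono) auto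
    finally show "measure gibbs {t<..} \<le> exp C * (F + 1) * exp (- \<eta> * t powr d)"
      by (simp add: c_def mult_ac)
  qed
qed

section \<open>Normalisation of the maximum\<close>

definition scale :: "nat \<Rightarrow> real" where
  "scale N = (ln (real N) / \<theta>) powr (1 / d)"

lemma scale_pos: "1 < N \<Longrightarrow> 0 < scale N"
  using theta_pos by (simp add: scale_def)

text \<open>The leading part of the potential at height \<open>x * scale N\<close> is
  \<open>x powr d * ln N\<close>, so a particle there costs the power \<open>x powr d\<close> of
  \<open>1 / N\<close>.\<close>

lemma scale_powr:
  assumes "1 < N" "0 \<le> x"
  shows "\<theta> * (x * scale N) powr d = x powr d * ln (real N)"
proof -
  have "scale N powr d = ln (real N) / \<theta>"
    using assms theta_pos d_ge_1 by (simp add: scale_def powr_powr)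
  then show ?thesis
    using assms scale_pos[of N] theta_pos by (simp add: powr_mult)
qed

lemma filterlim_scale: "filterlim scale at_top sequentially"
proof -
  have "0 < 1 / d" using d_ge_1 by simp
  then show ?thesis
    unfolding scale_def using theta_pos by real_asymp
qed

lemma eventually_scale_gt: "eventually (\<lambda>N. r < scale N) sequentially"
  using filterlim_scale by (simp add: filterlim_at_top_dense)

lemma Max_image_component:
  assumes "1 < (N::nat)"
  shows "finite (x ` {1..N})" "x ` {1..N} \<noteq> {}"
  using assms by auto

lemma xmax_prob_greaterThan:
  assumes "1 < N"
  shows "xmax_prob \<alpha> s V \<theta> d N {x<..} =
    measure (riesz_gas \<alpha> s V N) {y \<in> space (lborel_N N). \<exists>i\<in>{1..N}. y i \<in> {x * scale N<..}}"
proof -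
  have "scaled_x_max \<theta> d N y \<in> {x<..} \<longleftrightarrow> (\<exists>i\<in>{1..N}. y i \<in> {x * scale N<..})" for y
    using scale_pos[OF assms] Max_gr_iff[OF Max_image_component[OF assms, of y], of "x * scale N"]
    by (auto simp: scaled_x_max_def x_max_def pos_less_divide_eq simp flip: scale_def simp del: One_nat_def)
  then show ?thesis
    by (simp only: xmax_prob_def space_riesz_gas)
qed

lemma xmax_prob_lessThan:
  assumes "1 < N"
  shows "xmax_prob \<alpha> s V \<theta> d N {..<x} =
    measure (riesz_gas \<alpha> s V N) {y \<in> space (lborel_N N). \<forall>i\<in>{1..N}. y i < x * scale N}"
proof -
  have "scaled_x_max \<theta> d N y \<in> {..<x} \<longleftrightarrow> (\<forall>i\<in>{1..N}. y i < x * scale N)" for y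
    using scale_pos[OF assms] Max_less_iff[OF Max_image_component[OF assms, of y], of "x * scale N"]
    by (auto simp: scaled_x_max_def x_max_def pos_divide_less_eq simp flip: scale_def simp del: One_nat_def)
  then show ?thesis
    by (simp only: xmax_prob_def space_riesz_gas)
qed

lemma scaled_x_max_sets:
  assumes "1 < N" "A \<in> sets borel"
  shows "{y \<in> space (riesz_gas \<alpha> s V N). scaled_x_max \<theta> d N y \<in> A} \<in> sets (riesz_gas \<alpha> s V N)"
proof -
  have "(\<lambda>y. Max (y ` {1..N})) \<in> borel_measurable (lborel_N N)"
    by (rule borel_measurable_Max) (use borel_measurable_lborel_N_component in auto)
  then have "scaled_x_max \<theta> d N \<in> borel_measurable (riesz_gas \<alpha> s V N)"
    unfolding scaled_x_max_def x_max_def by measurable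
  then show ?thesis using assms(2) by measurable
qed

lemma xmax_prob_mono:
  assumes "1 < N" "A \<subseteq> B" "B \<in> sets borel"
  shows "xmax_prob \<alpha> s V \<theta> d N A \<le> xmax_prob \<alpha> s V \<theta> d N B"
proof -
  interpret prob_space "riesz_gas \<alpha> s V N"
    by (rule prob_space_riesz_gas)
  show ?thesis
    unfolding xmax_prob_def using scaled_x_max_sets[OF assms(1,3)] assms(2)
    by (intro finite_measure_mono) auto
qed

lemma xmax_prob_nonneg: "0 \<le> xmax_prob \<alpha> s V \<theta> d N A"
  by (simp add: xmax_prob_def)

section \<open>Upper tail\<close>

text \<open>The union bound contributes one power of \<open>N\<close>, and the Gibbs tail the power
  \<open>- z * x powr d\<close>. The factor \<open>z < 1\<close> pays for the perturbation in the
  potential.\<close>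

lemma xmax_prob_greaterThan_le:
  assumes z: "0 < z" "z < 1"
  obtains C where "0 < C" "\<And>N x. 1 < N \<Longrightarrow> 0 \<le> x \<Longrightarrow>
    xmax_prob \<alpha> s V \<theta> d N {x<..} \<le> C * exp ((1 - z * x powr d) * ln (real N))"
proof -
  obtain M where M: "\<And>y. y \<in> {0..1} \<Longrightarrow> V y \<le> M"
    using continuous_bounded_on_cball[OF continuous_V, of 1] by (metis abs_le_D1 abs_of_nonneg atLeastAtMost_iff)
  obtain C where C: "0 < C" "\<And>t. 0 \<le> t \<Longrightarrow> measure gibbs {t<..} \<le> C * exp (- (z * \<theta>) * t powr d)"
    using gibbs_tail[of "z * \<theta>"] z theta_pos by auto
  show ?thesis
  proof (rule that[of "exp (screening \<alpha> s + M) * C"])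
    fix N :: nat and x :: real assume N: "1 < N" and x: "0 \<le> x"
    have "xmax_prob \<alpha> s V \<theta> d N {x<..} \<le> real N * (exp (screening \<alpha> s + M) * measure gibbs {x * scale N<..})"
      unfolding xmax_prob_greaterThan[OF N] by (rule measure_exists_le[OF M]) auto
    also have "\<dots> \<le> real N * (exp (screening \<alpha> s + M) * (C * exp (- (z * \<theta>) * (x * scale N) powr d)))"
      using scale_pos[OF N] x by (intro mult_left_mono C) auto
    also have "- (z * \<theta>) * (x * scale N) powr d = - (z * x powr d * ln (real N))"
      using scale_powr[OF N x] by (simp add: mult.assoc)
    also have "real N * (exp (screening \<alpha> s + M) * (C * exp (- (z * x powr d * ln (real N)))))
        = exp (screening \<alpha> s + M) * C * (exp (ln (real N)) * exp (- (z * x powr d * ln (real N))))"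
      using N by simp
    also have "exp (ln (real N)) * exp (- (z * x powr d * ln (real N))) = exp ((1 - z * x powr d) * ln (real N))"
      by (simp add: algebra_simps flip: exp_add)
    finally show "xmax_prob \<alpha> s V \<theta> d N {x<..} \<le>
      exp (screening \<alpha> s + M) * C * exp ((1 - z * x powr d) * ln (real N))" .
  qed (use C in simp)
qed

text \<open>The constant depends on \<open>z\<close>, so \<open>N\<close> tends to infinity first
  for fixed \<open>z\<close>; only then does \<open>z\<close> increase to 1.\<close>

lemma limsup_greaterThan:
  assumes x: "0 \<le> x"
  shows "limsup (\<lambda>N. ereal (1 / ln (real N)) * log_prob (xmax_prob \<alpha> s V \<theta> d N {x<..})) \<le> ereal (1 - x powr d)"
proof (rule tendsto_lowerbound)
  have "((\<lambda>z. 1 - z * x powr d) \<longlongrightarrow> 1 - 1 * x powr d) (at_left 1)"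
    by (intro tendsto_intros)
  then show "((\<lambda>z. ereal (1 - z * x powr d)) \<longlongrightarrow> ereal (1 - x powr d)) (at_left 1)"
    by simp
  have "\<forall>\<^sub>F z in at_left 1. z \<in> {0<..<1::real}"
    by (rule eventually_at_left_real) simp
  then show "\<forall>\<^sub>F z in at_left 1. limsup (\<lambda>N. ereal (1 / ln (real N)) * log_prob (xmax_prob \<alpha> s V \<theta> d N {x<..}))
      \<le> ereal (1 - z * x powr d)"
  proof eventually_elim
    case (elim z)
    then obtain C where C: "0 < C" "\<And>N x. 1 < N \<Longrightarrow> 0 \<le> x \<Longrightarrow>
      xmax_prob \<alpha> s V \<theta> d N {x<..} \<le> C * exp ((1 - z * x powr d) * ln (real N))"
      using xmax_prob_greaterThan_le[of z] by auto
    show ?case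
    proof (rule limsup_log_prob_le)
      show "\<forall>\<^sub>F N in sequentially. 0 \<le> xmax_prob \<alpha> s V \<theta> d N {x<..} \<and>
        xmax_prob \<alpha> s V \<theta> d N {x<..} \<le> C * exp ((1 - z * x powr d) * ln (real N))"
        using eventually_gt_at_top[of 1] by eventually_elim (auto intro: xmax_prob_nonneg C x)
    qed (rule C)
  qed
qed simp

text \<open>Provides the typical event for the lower bound: with probability at least one half no
  particle exceeds a level above 1.\<close>

lemma eventually_xmax_prob_greaterThan_le_half:
  assumes x: "1 < x"
  shows "\<forall>\<^sub>F N in sequentially. xmax_prob \<alpha> s V \<theta> d N {x<..} \<le> 1 / 2"
proof -
  \<comment> \<open>The midpoint of \<open>1 / x powr d\<close> and 1: it is below 1 and still
    satisfies \<open>z * x powr d > 1\<close>, so the exponent is negative.\<close>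
  define q z where "q = 1 / x powr d" and "z = (1 + q) / 2"
  have xd: "1 < x powr d" using x d_ge_1 by (intro gr_one_powr) auto
  then have "0 < q" "q < 1"
    by (auto simp: q_def divide_less_eq)
  then have z: "0 < z" "z < 1"
    by (simp_all add: z_def)
  have e: "1 - z * x powr d < 0"
    using x xd by (simp add: z_def q_def field_simps)
  obtain C where C: "0 < C" "\<And>N x. 1 < N \<Longrightarrow> 0 \<le> x \<Longrightarrow>
      xmax_prob \<alpha> s V \<theta> d N {x<..} \<le> C * exp ((1 - z * x powr d) * ln (real N))"
    using xmax_prob_greaterThan_le[OF z] by auto
  have "(\<lambda>N. C * exp ((1 - z * x powr d) * ln (real N))) \<longlonglongrightarrow> 0"
    using e by real_asymp
  then have "\<forall>\<^sub>F N in sequentially. C * exp ((1 - z * x powr d) * ln (real N)) < 1 / 2"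
    by (rule order_tendstoD) simp
  then show ?thesis
    using eventually_gt_at_top[of 1]
  proof eventually_elim
    case (elim N)
    then show ?case using C(2)[of N x] x by auto
  qed
qed

section \<open>Lower bound for windows\<close>

text \<open>Once \<open>1 < \<delta> * scale N\<close>, the unit interval starting at
  \<open>x * scale N\<close> ends before \<open>(x + \<delta>) * scale N\<close>, so its length
  costs only a shift of \<open>x\<close> by \<open>\<delta>\<close>.\<close>

lemma V_le_near:
  assumes C: "\<And>y. V y \<le> z * \<theta> * \<bar>y\<bar> powr d + C" and "0 < z" "0 \<le> x" "1 < N" "1 < \<delta> * scale N"
    and y: "y \<in> {x * scale N..x * scale N + 1}"
  shows "V y \<le> z * (x + \<delta>) powr d * ln (real N) + C"
proof -
  have c: "0 < scale N" using assms scale_pos by simp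
  have "0 \<le> x * scale N"
    using assms c by simp
  then have "\<bar>y\<bar> \<le> (x + \<delta>) * scale N"
    using y assms by (simp add: distrib_right)
  then have "\<bar>y\<bar> powr d \<le> ((x + \<delta>) * scale N) powr d"
    using d_ge_1 by (intro powr_mono2) auto
  then have "z * (\<theta> * \<bar>y\<bar> powr d) \<le> z * (\<theta> * ((x + \<delta>) * scale N) powr d)"
    using assms theta_pos by (intro mult_left_mono) auto
  also have "\<theta> * ((x + \<delta>) * scale N) powr d = (x + \<delta>) powr d * ln (real N)"
  proof (rule scale_powr)
    have "0 < \<delta>" using assms(5) c by (metis less_trans zero_less_mult_pos2 zero_less_one)
    then show "0 \<le> x + \<delta>" using assms(3) by simp
  qed fact
  finally show ?thesis using C[of y] by (simp add: mult.assoc)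
qed

text \<open>With probability at least one half all particles lie at or below
  \<open>(x - \<delta>) * scale N\<close>. Moving one of them just above \<open>x * scale N\<close>
  puts the maximum into the window. The choice of the particle gives the factor \<open>N\<close>,
  its new position the cost \<open>exp (- M)\<close>.\<close>

lemma xmax_prob_interval_ge:
  assumes C: "\<And>y. V y \<le> z * \<theta> * \<bar>y\<bar> powr d + C" and "0 < z" "0 \<le> x" "1 < N" "1 < \<delta> * scale N"
    and half: "xmax_prob \<alpha> s V \<theta> d N {x - \<delta><..} \<le> 1 / 2"
  shows "exp (- screening \<alpha> s - C) / (2 * (measure gibbs UNIV + 1)) * exp ((1 - z * (x + \<delta>) powr d) * ln (real N))
    \<le> xmax_prob \<alpha> s V \<theta> d N {x - \<delta><..<x + \<delta>}"
proof -
  interpret prob_space "riesz_gas \<alpha> s V N"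
    by (rule prob_space_riesz_gas)
  let ?P = "measure (riesz_gas \<alpha> s V N)"
  define a b M where "a = x * scale N" and "b = (x - \<delta>) * scale N"
    and "M = z * (x + \<delta>) powr d * ln (real N) + C"
  have c: "0 < scale N" using assms scale_pos by simp
  have ba: "b < a" and a1: "a + 1 < (x + \<delta>) * scale N"
    using assms(5) by (auto simp: a_def b_def algebra_simps)
  let ?E = "{y \<in> space (lborel_N N). \<exists>i\<in>{1..N}. y i \<in> {a..a+1} \<and> (\<forall>j\<in>{1..N}-{i}. y j \<le> b)}"
  let ?L = "{y \<in> space (lborel_N N). \<forall>i\<in>{1..N}. y i \<le> b}"
  let ?G = "{y \<in> space (riesz_gas \<alpha> s V N). \<exists>i\<in>{1..N}. y i \<in> {b<..}}"
  have L: "?L = space (riesz_gas \<alpha> s V N) - ?G"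
    by (auto simp: not_less simp del: One_nat_def)
  have G: "?G \<in> sets (riesz_gas \<alpha> s V N)"
  proof -
    have "?G = (\<Union>i\<in>{1..N}. {y \<in> space (lborel_N N). b < y i})" by auto
    moreover have "{y \<in> space (lborel_N N). b < y i} \<in> sets (lborel_N N)" if "i \<in> {1..N}" for i
      using borel_measurable_lborel_N_component[OF that] by measurable
    ultimately show ?thesis
      by (simp only: sets_riesz_gas) (intro sets.finite_UN; simp del: One_nat_def)
  qed
  have "?P ?G \<le> 1 / 2"
    using half unfolding xmax_prob_greaterThan[OF assms(4)] b_def space_riesz_gas .
  then have half': "1 / 2 \<le> ?P ?L"
    unfolding L prob_compl[OF G] by linarith
  have "?E \<subseteq> {y \<in> space (riesz_gas \<alpha> s V N). scaled_x_max \<theta> d N y \<in> {x - \<delta><..<x + \<delta>}}"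
  proof
    fix y assume y: "y \<in> ?E"
    then obtain i where i: "i \<in> {1..N}" "y i \<in> {a..a+1}" "\<And>j. j \<in> {1..N} - {i} \<Longrightarrow> y j \<le> b"
      by auto
    have "Max (y ` {1..N}) = y i"
    proof (rule Max_eqI)
      fix u assume "u \<in> y ` {1..N}"
      then obtain j where "j \<in> {1..N}" "u = y j" by auto
      then show "u \<le> y i" using i ba by (cases "j = i") force+
    qed (use i in auto)
    then have "scaled_x_max \<theta> d N y = y i / scale N"
      by (simp add: scaled_x_max_def x_max_def scale_def)
    moreover have "(x - \<delta>) * scale N < y i" "y i < (x + \<delta>) * scale N"
      using i(2) ba a1 by (auto simp: b_def)
    ultimately show "y \<in> {y \<in> space (riesz_gas \<alpha> s V N). scaled_x_max \<theta> d N y \<in> {x - \<delta><..<x + \<delta>}}"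
      using y c by (simp add: pos_less_divide_eq pos_divide_less_eq)
  qed
  then have E_le: "?P ?E \<le> xmax_prob \<alpha> s V \<theta> d N {x - \<delta><..<x + \<delta>}"
    unfolding xmax_prob_def by (intro finite_measure_mono scaled_x_max_sets assms) auto
  have "real N * (exp (- screening \<alpha> s - M) * (1 / 2)) \<le> real N * (exp (- screening \<alpha> s - M) * ?P ?L)"
    using half' by (intro mult_left_mono) auto
  also have "\<dots> \<le> measure gibbs UNIV * ?P ?E"
  proof (rule measure_one_outlier_ge[OF _ ba])
    fix y assume "y \<in> {a..a+1}"
    then show "V y \<le> M"
      unfolding M_def a_def using assms by (intro V_le_near) auto
  qed
  \<comment> \<open>Adding 1 to the total mass makes the divisor positive for the next step.\<close>
  also have "\<dots> \<le> (measure gibbs UNIV + 1) * xmax_prob \<alpha> s V \<theta> d N {x - \<delta><..<x + \<delta>}"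
    using E_le by (intro mult_mono) auto
  finally have "real N * exp (- screening \<alpha> s - M) / (2 * (measure gibbs UNIV + 1))
      \<le> xmax_prob \<alpha> s V \<theta> d N {x - \<delta><..<x + \<delta>}"
    using add_nonneg_pos[of "measure gibbs UNIV" 1]
    by (subst pos_divide_le_eq) (auto simp: algebra_simps)
  moreover have "real N * exp (- screening \<alpha> s - M)
      = exp (- screening \<alpha> s - C) * exp ((1 - z * (x + \<delta>) powr d) * ln (real N))"
  proof -
    have "real N * exp (- screening \<alpha> s - M) = exp (ln (real N)) * exp (- screening \<alpha> s - M)"
      using assms(4) by simp
    then show ?thesis by (simp add: M_def algebra_simps flip: exp_add)
  qed
  ultimately show ?thesis by simp
qed

lemma liminf_interval_ge_aux:
  assumes x: "1 < x" and \<delta>: "0 < \<delta>" "\<delta> < x - 1" and z: "1 < z"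
  shows "ereal (1 - z * (x + \<delta>) powr d)
    \<le> liminf (\<lambda>N. ereal (1 / ln (real N)) * log_prob (xmax_prob \<alpha> s V \<theta> d N {x - \<delta><..<x + \<delta>}))"
proof -
  obtain C where C: "\<And>y. V y \<le> z * \<theta> * \<bar>y\<bar> powr d + C"
    using admissible_potential_le[OF admissible theta_pos, of "z * \<theta>"] z theta_pos by auto
  show ?thesis
  proof (rule liminf_log_prob_ge)
    \<comment> \<open>The typical event is available only at levels above 1, hence the restriction
      on \<open>\<delta>\<close>.\<close>
    have "1 < x - \<delta>" using \<delta> by simp
    from eventually_xmax_prob_greaterThan_le_half[OF this]
    show "\<forall>\<^sub>F N in sequentially. exp (- screening \<alpha> s - C) / (2 * (measure gibbs UNIV + 1)) *
        exp ((1 - z * (x + \<delta>) powr d) * ln (real N)) \<le> xmax_prob \<alpha> s V \<theta> d N {x - \<delta><..<x + \<delta>}"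
      using eventually_gt_at_top[of 1] eventually_scale_gt[of "1 / \<delta>"]
    proof eventually_elim
      case (elim N)
      then show ?case
        using x z \<delta> by (intro xmax_prob_interval_ge C) (auto simp: field_simps)
    qed
    show "0 < exp (- screening \<alpha> s - C) / (2 * (measure gibbs UNIV + 1))"
      by (simp add: add_nonneg_pos)
  qed
qed

lemma liminf_interval_mono:
  assumes "0 < \<delta>" "\<delta> \<le> \<delta>'"
  shows "liminf (\<lambda>N. ereal (1 / ln (real N)) * log_prob (xmax_prob \<alpha> s V \<theta> d N {x - \<delta><..<x + \<delta>}))
    \<le> liminf (\<lambda>N. ereal (1 / ln (real N)) * log_prob (xmax_prob \<alpha> s V \<theta> d N {x - \<delta>'<..<x + \<delta>'}))"
proof (rule Liminf_mono)
  show "\<forall>\<^sub>F N in sequentially. ereal (1 / ln (real N)) * log_prob (xmax_prob \<alpha> s V \<theta> d N {x - \<delta><..<x + \<delta>})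
    \<le> ereal (1 / ln (real N)) * log_prob (xmax_prob \<alpha> s V \<theta> d N {x - \<delta>'<..<x + \<delta>'})"
    using eventually_gt_at_top[of 1]
  proof eventually_elim
    case (elim N)
    then show ?case
      using assms by (intro ereal_mult_left_mono log_prob_mono xmax_prob_nonneg xmax_prob_mono) auto
  qed
qed

text \<open>A single parameter \<open>\<epsilon>\<close> serves as the window width and as the
  excess of \<open>z\<close> over 1. Small windows lie inside the window of width
  \<open>\<delta>\<close>, so their bound carries over by monotonicity, and letting
  \<open>\<epsilon>\<close> tend to 0 removes both losses.\<close>

lemma liminf_interval_ge:
  assumes x: "1 < x" and \<delta>: "0 < \<delta>"
  shows "ereal (1 - x powr d)
    \<le> liminf (\<lambda>N. ereal (1 / ln (real N)) * log_prob (xmax_prob \<alpha> s V \<theta> d N {x - \<delta><..<x + \<delta>}))"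
    (is "_ \<le> ?f \<delta>")
proof (rule tendsto_upperbound)
  have "((\<lambda>\<epsilon>. 1 - (1 + \<epsilon>) * (x + \<epsilon>) powr d) \<longlongrightarrow> 1 - (1 + 0) * (x + 0) powr d) (at_right 0)"
    using x by (intro tendsto_intros) auto
  then show "((\<lambda>\<epsilon>. ereal (1 - (1 + \<epsilon>) * (x + \<epsilon>) powr d)) \<longlongrightarrow> ereal (1 - x powr d)) (at_right 0)"
    by simp
  have "\<forall>\<^sub>F \<epsilon> in at_right 0. \<epsilon> \<in> {0<..<min \<delta> (x - 1)}"
    by (rule eventually_at_right_real) (use x \<delta> in simp)
  then show "\<forall>\<^sub>F \<epsilon> in at_right 0. ereal (1 - (1 + \<epsilon>) * (x + \<epsilon>) powr d) \<le> ?f \<delta>"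
  proof eventually_elim
    case (elim \<epsilon>)
    then have "ereal (1 - (1 + \<epsilon>) * (x + \<epsilon>) powr d) \<le> ?f \<epsilon>"
      using x by (intro liminf_interval_ge_aux) auto
    also have "?f \<epsilon> \<le> ?f \<delta>"
      using elim by (intro liminf_interval_mono) auto
    finally show ?case .
  qed
qed simp

section \<open>Lower tail\<close>

text \<open>Each of the \<open>k\<close> lifts gains \<open>1 / N\<close> from the choice of a
  particle and costs \<open>z * (x + \<delta>) powr d\<close> powers of \<open>N\<close>. The net
  exponent is negative when \<open>z * (x + \<delta>) powr d < 1\<close>.\<close>

lemma xmax_prob_lessThan_le:
  assumes C: "\<And>y. V y \<le> z * \<theta> * \<bar>y\<bar> powr d + C" and "0 < z" "0 \<le> x" "1 < N" "1 < \<delta> * scale N" "2 * k \<le> N"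
  shows "xmax_prob \<alpha> s V \<theta> d N {..<x}
    \<le> fact k * (2 * (measure gibbs UNIV + 1) * exp (screening \<alpha> s + C)) ^ k
      * exp (- (real k * (1 - z * (x + \<delta>) powr d)) * ln (real N))"
proof -
  define M where "M = z * (x + \<delta>) powr d * ln (real N) + C"
  have "xmax_prob \<alpha> s V \<theta> d N {..<x} \<le> fact k * (2 * measure gibbs UNIV * exp (screening \<alpha> s + M) / real N) ^ k"
    unfolding xmax_prob_lessThan[OF assms(4)]
  proof (rule measure_all_below_le)
    fix y assume "y \<in> {x * scale N..x * scale N + 1}"
    then show "V y \<le> M"
      unfolding M_def using assms by (intro V_le_near) auto
  qed (use assms in auto)
  also have "\<dots> \<le> fact k * (2 * (measure gibbs UNIV + 1) * exp (screening \<alpha> s + M) / real N) ^ k"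
    by (intro mult_left_mono power_mono divide_right_mono mult_right_mono) auto
  also have "2 * (measure gibbs UNIV + 1) * exp (screening \<alpha> s + M) / real N
      = 2 * (measure gibbs UNIV + 1) * exp (screening \<alpha> s + C) * exp (- ((1 - z * (x + \<delta>) powr d) * ln (real N)))"
  proof -
    have "exp (screening \<alpha> s + M) / real N = exp (screening \<alpha> s + M) / exp (ln (real N))"
      using assms(4) by simp
    also have "\<dots> = exp (screening \<alpha> s + C) * exp (- ((1 - z * (x + \<delta>) powr d) * ln (real N)))"
      by (simp add: M_def algebra_simps flip: exp_add exp_diff)
    finally show ?thesis
      by (simp only: mult.assoc times_divide_eq_right[symmetric])
  qed
  also have "fact k * (2 * (measure gibbs UNIV + 1) * exp (screening \<alpha> s + C) * exp (- ((1 - z * (x + \<delta>) powr d) * ln (real N)))) ^ k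
      = fact k * (2 * (measure gibbs UNIV + 1) * exp (screening \<alpha> s + C)) ^ k
      * exp (- (real k * (1 - z * (x + \<delta>) powr d)) * ln (real N))"
    by (simp add: power_mult_distrib mult.assoc flip: exp_of_nat_mult)
  finally show ?thesis .
qed

text \<open>For each fixed \<open>k\<close> the limit superior is at most
  \<open>- k * \<gamma>\<close> with the same \<open>\<gamma> > 0\<close>; as \<open>k\<close> is
  arbitrary, it is minus infinity.\<close>

lemma lessThan_tendsto:
  assumes "x < 1"
  shows "(\<lambda>N. ereal (1 / ln (real N)) * log_prob (xmax_prob \<alpha> s V \<theta> d N {..<x})) \<longlonglongrightarrow> - \<infinity>"
proof -
  \<comment> \<open>The preceding bound requires a nonnegative level, while \<open>x\<close> may be
    negative; enlarging it to \<open>y\<close> only enlarges the event. Half of the gap to 1 is kept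
    as \<open>\<delta>\<close>.\<close>
  define y \<delta> where "y = max x (1 / 2)" and "\<delta> = (1 - y) / 2"
  have "1 / 2 \<le> y" "x \<le> y" "y < 1"
    using assms by (auto simp: y_def)
  then have y: "0 < y" "x \<le> y" "0 < \<delta>" "0 < y + \<delta>" "y + \<delta> < 1"
    unfolding \<delta>_def by (simp_all add: field_simps)
  \<comment> \<open>The midpoint of 1 and \<open>1 / u\<close> exceeds 1, as the upper bound on
    \<open>V\<close> requires, and gives \<open>z * u = (1 + u) / 2 < 1\<close>.\<close>
  define u z \<gamma> where "u = (y + \<delta>) powr d" and "z = (1 + 1 / u) / 2" and "\<gamma> = 1 - z * u"
  have u: "0 < u" "u < 1"
    using y d_ge_1 powr_less_mono2[of d "y + \<delta>" 1] by (auto simp: u_def)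
  then have z: "1 < z" and \<gamma>: "0 < \<gamma>"
    by (auto simp: z_def \<gamma>_def field_simps)
  obtain C where C: "\<And>y. V y \<le> z * \<theta> * \<bar>y\<bar> powr d + C"
    using admissible_potential_le[OF admissible theta_pos, of "z * \<theta>"] z theta_pos by auto
  let ?f = "\<lambda>N. ereal (1 / ln (real N)) * log_prob (xmax_prob \<alpha> s V \<theta> d N {..<x})"
  have le: "limsup ?f \<le> ereal (- (real k * \<gamma>))" for k
  proof (rule limsup_log_prob_le)
    show "0 < fact k * (2 * (measure gibbs UNIV + 1) * exp (screening \<alpha> s + C)) ^ k"
      by (simp add: add_nonneg_pos)
    show "\<forall>\<^sub>F N in sequentially. 0 \<le> xmax_prob \<alpha> s V \<theta> d N {..<x} \<and> xmax_prob \<alpha> s V \<theta> d N {..<x}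
        \<le> fact k * (2 * (measure gibbs UNIV + 1) * exp (screening \<alpha> s + C)) ^ k * exp (- (real k * \<gamma>) * ln (real N))"
      using eventually_gt_at_top[of 1] eventually_ge_at_top[of "2 * k"] eventually_scale_gt[of "1 / \<delta>"]
    proof eventually_elim
      case (elim N)
      have "xmax_prob \<alpha> s V \<theta> d N {..<x} \<le> xmax_prob \<alpha> s V \<theta> d N {..<y}"
        using elim y by (intro xmax_prob_mono) auto
      also have "\<dots> \<le> fact k * (2 * (measure gibbs UNIV + 1) * exp (screening \<alpha> s + C)) ^ k
          * exp (- (real k * \<gamma>) * ln (real N))"
        unfolding \<gamma>_def u_def using elim y z
        by (intro xmax_prob_lessThan_le C) (auto simp: field_simps)
      finally show ?case using xmax_prob_nonneg by simp
    qed
  qed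
  have "limsup ?f = - \<infinity>"
  proof (rule ereal_bot)
    fix B
    obtain k where "- B < real k * \<gamma>"
      using \<gamma> ex_less_of_nat_mult[of \<gamma> "- B"] by auto
    then have "ereal (- (real k * \<gamma>)) \<le> ereal B" by simp
    with le[of k] show "limsup ?f \<le> ereal B" by (rule order_trans)
  qed
  then show ?thesis by (simp add: Limsup_MInfty)
qed

end

theorem theorem1p3:
  fixes \<alpha> s \<theta> d :: real and V :: "real \<Rightarrow> real"
  assumes "\<alpha> > 0" and "0 < s" and "s < 1" and "d \<ge> 1" and "\<theta> > 0"
    and "admissible_potential V \<theta> d"
  shows
    "(\<forall>x>1.
        limsup (\<lambda>N. ereal (1 / ln (real N)) * log_prob (xmax_prob \<alpha> s V \<theta> d N {x<..}))
          \<le> - rate d x \<and>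
        (\<exists>L. ((\<lambda>\<delta>. liminf (\<lambda>N. ereal (1 / ln (real N)) *
                log_prob (xmax_prob \<alpha> s V \<theta> d N {x - \<delta><..<x + \<delta>}))) \<longlongrightarrow> L) (at_right 0) \<and>
             - rate d x \<le> L)) \<and>
     (\<forall>x < ((1 - s) / (1 + s)) powr (1 / d).
        ((\<lambda>N. ereal (1 / ln (real N)) * log_prob (xmax_prob \<alpha> s V \<theta> d N {..<x}))
          \<longlonglongrightarrow> - rate d x) \<and>
        - rate d x = - \<infinity>)"
proof -
  interpret confined_riesz_ensemble \<alpha> s \<theta> d V
    using assms by unfold_locales auto
  have rate: "- rate d x = ereal (1 - x powr d)" if "1 < x" for x
    using that by (simp add: rate_def)
  \<comment> \<open>This places the range of the second claim inside \<open>x < 1\<close>, where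
    \<open>lessThan_tendsto\<close> applies and the rate is infinite.\<close>
  have "((1 - s) / (1 + s)) powr (1 / d) \<le> 1"
    using assms by (intro powr_le1) auto
  then have x: "x < 1" and rate': "- rate d x = - \<infinity>" if "x < ((1 - s) / (1 + s)) powr (1 / d)" for x
    using that by (auto simp: rate_def)
  show ?thesis
    using limsup_greaterThan liminf_interval_ge liminf_interval_mono lessThan_tendsto x rate'
    by (auto simp: rate intro!: mono_at_right_zero_limit)
qed

end
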